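(* There exist absolute constants $c_1,c_2,c_3>0$ with the following property. For every integer $k>0$ and every (randomized) memoryless routing algorithm $\mathcal{A}$, there exists a convex subdivision $G=(V,E)$ and vertices $s,t\in V$ such that: <ul> <li>$c_1k\le |V|\le c_2k$, and</li> <li>the expected number of steps taken by $\mathcal{A}$ when routing a packet from $s$ to $t$ in $G$ is at least $c_3k^2$.</li> </ul>
   Context: A geometric graph $G=(V,E)$ has vertex set $V\subset\mathbb{R}^2$ and straight-line edges. A convex subdivision is a plane geometric graph all of whose faces, except the outer face, are convex polygons, and whose outer face is the complement of a convex polygon. For a vertex $v$, $N(v)$ denotes the set of neighbours of $v$. A randomized memoryless routing algorithm is given by a function $f:\mathbb{R}^2\times\mathbb{R}^2\times(\mathbb{R}^2)^+\times\{0,1\}^\infty\to\mathbb{R}^2$ such that $f(v,t,N(v),B)\in N(v)$ and $f(t,t,N(t),B)=t$ for all inputs. To route a packet toward $t$ while it is at vertex $v$, the algorithm moves it to $f(v,t,N(v),B)$, where $B$ is a sequence of random bits chosen fresh and independently at each step. Thus the decision depends only on the coordinates of $v$, of $t$, and of the neighbours of $v$, together with fresh randomness. A deterministic memoryless routing algorithm is the special case where $f$ does not depend on $B$. The number of steps is the number of moves made until the packet first reaches $t$. Its expectation may be infinite. *)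

theory Defs
  imports "HOL-Probability.Probability"
begin

type_synonym point = "real ^ 2"

definition seg :: "point set \<Rightarrow> point set" where
  "seg e = (\<Union>u\<in>e. \<Union>v\<in>e. closed_segment u v)"

definition geometric_graph :: "point set \<Rightarrow> point set set \<Rightarrow> bool" where
  "geometric_graph V E \<longleftrightarrow> finite V \<and>
     (\<forall>e\<in>E. \<exists>u v. e = {u, v} \<and> u \<noteq> v \<and> u \<in> V \<and> v \<in> V)"

definition plane_geometric_graph :: "point set \<Rightarrow> point set set \<Rightarrow> bool" where
  "plane_geometric_graph V E \<longleftrightarrow> geometric_graph V E \<and>
     (\<forall>e1\<in>E. \<forall>e2\<in>E. e1 \<noteq> e2 \<longrightarrow> seg e1 \<inter> seg e2 = e1 \<inter> e2) \<and>
     (\<forall>v\<in>V. \<forall>e\<in>E. v \<in> seg e \<longrightarrow> v \<in> e)"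

definition faces :: "point set \<Rightarrow> point set set \<Rightarrow> point set set" where
  "faces V E = components (UNIV - (V \<union> (\<Union>e\<in>E. seg e)))"

text \<open>A convex polygon: the convex hull of finitely many points, with nonempty interior.
  As faces are open, a bounded face "is" a convex polygon when it equals the interior of one.\<close>
definition convex_polygon :: "point set \<Rightarrow> bool" where
  "convex_polygon P \<longleftrightarrow> (\<exists>Q. finite Q \<and> P = convex hull Q) \<and> interior P \<noteq> {}"

definition convex_subdivision :: "point set \<Rightarrow> point set set \<Rightarrow> bool" where
  "convex_subdivision V E \<longleftrightarrow> plane_geometric_graph V E \<and>
     (\<forall>F\<in>faces V E.
        (bounded F \<longrightarrow> (\<exists>P. convex_polygon P \<and> F = interior P)) \<and>
        (\<not> bounded F \<longrightarrow> (\<exists>P. convex_polygon P \<and> F = - P)))"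

definition nbrs :: "point set set \<Rightarrow> point \<Rightarrow> point set" where
  "nbrs E v = {u. {u, v} \<in> E}"

definition coins :: "(nat \<Rightarrow> bool) measure" where
  "coins = PiM UNIV (\<lambda>_. measure_pmf (bernoulli_pmf (1/2)))"

definition memoryless_routing ::
  "(point \<Rightarrow> point \<Rightarrow> point set \<Rightarrow> (nat \<Rightarrow> bool) \<Rightarrow> point) \<Rightarrow> bool" where
  "memoryless_routing f \<longleftrightarrow>
     (\<forall>v t N B. finite N \<and> N \<noteq> {} \<and> v \<noteq> t \<longrightarrow> f v t N B \<in> N) \<and>
     (\<forall>t N B. f t t N B = t) \<and>
     (\<forall>v t N. f v t N \<in> coins \<rightarrow>\<^sub>M count_space UNIV)"

primrec route ::
  "(point \<Rightarrow> point \<Rightarrow> point set \<Rightarrow> (nat \<Rightarrow> bool) \<Rightarrow> point) \<Rightarrow> point set set \<Rightarrow>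
   point \<Rightarrow> point \<Rightarrow> (nat \<Rightarrow> nat \<Rightarrow> bool) \<Rightarrow> nat \<Rightarrow> point" where
  "route f E s t \<omega> 0 = s"
| "route f E s t \<omega> (Suc n) =
     f (route f E s t \<omega> n) t (nbrs E (route f E s t \<omega> n)) (\<omega> n)"

definition num_steps ::
  "(point \<Rightarrow> point \<Rightarrow> point set \<Rightarrow> (nat \<Rightarrow> bool) \<Rightarrow> point) \<Rightarrow> point set set \<Rightarrow>
   point \<Rightarrow> point \<Rightarrow> (nat \<Rightarrow> nat \<Rightarrow> bool) \<Rightarrow> ennreal" where
  "num_steps f E s t \<omega> =
     (if \<exists>n. route f E s t \<omega> n = t then ennreal (real (LEAST n. route f E s t \<omega> n = t))
      else \<infinity>)"

definition expected_steps ::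
  "(point \<Rightarrow> point \<Rightarrow> point set \<Rightarrow> (nat \<Rightarrow> bool) \<Rightarrow> point) \<Rightarrow> point set set \<Rightarrow>
   point \<Rightarrow> point \<Rightarrow> ennreal" where
  "expected_steps f E s t = (\<integral>\<^sup>+ \<omega>. num_steps f E s t \<omega> \<partial>(PiM UNIV (\<lambda>_. coins)))"

end

theory Submission
  imports Defs
begin

text \<open>
  Subdivide a segment into \<open>k\<close> pieces. In the interior of such a chain the algorithm performs a
  birth-death walk, and the two hitting times between the ends sum up to the commute time, which by
  Cauchy-Schwarz is at least \<open>2 k\<^sup>2\<close>. So every segment \<open>a b\<close> has a direction, say from \<open>a\<close> to \<open>b\<close>
  (the packet drifts from \<open>a\<close> to \<open>b\<close>), against which it takes \<open>k\<^sup>2\<close> expected steps to cross, and the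
  adversary knows these directions. It therefore suffices to find a subdivision of bounded size with
  a set \<open>S\<close> of vertices, \<open>t \<notin> S\<close>, such that along all edges between \<open>S\<close> and its complement the
  packet drifts into \<open>S\<close>.

  Suppose that there is none, and take a triangle with centroid \<open>t\<close>. If a side drifts, in its middle
  third, counterclockwise around \<open>t\<close>, then so does the rest of its line beyond that third, since two
  opposite drifts on a line not through \<open>t\<close> would trap the packet at a vertex of a triangle with corner
  \<open>t\<close>. A counterclockwise and a clockwise side would trap it at their common corner. Hence all three
  sides turn the same way, and extending each of them beyond its corner up to a surrounding triangle
  gives a pinwheel whose three outer vertices are a trap.
\<close>

section \<open>Potentials bound the number of steps\<close>

lemma prob_space_coins: "prob_space coins"
  unfolding coins_def by (intro prob_space_PiM measure_pmf.prob_space_axioms)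

interpretation coin_seq: sequence_space coins
  unfolding sequence_space_def by (rule product_prob_spaceI) (rule prob_space_coins)

lemma memoryless_routing_measurable: "memoryless_routing f \<Longrightarrow> f v t N \<in> coins \<rightarrow>\<^sub>M count_space UNIV"
  and memoryless_routing_in: "memoryless_routing f \<Longrightarrow> finite N \<Longrightarrow> N \<noteq> {} \<Longrightarrow> v \<noteq> t \<Longrightarrow> f v t N B \<in> N"
  and memoryless_routing_target: "memoryless_routing f \<Longrightarrow> f t t N B = t"
  by (simp_all add: memoryless_routing_def)

text \<open>\<open>route\<close> is defined by its last step; conditioning on the first coin needs
  the first step split off instead.\<close>

lemma route_case_nat:
  "route f E v t (case_nat b \<omega>) (Suc n) = route f E (f v t (nbrs E v) b) t \<omega> n"
  by (induction n) auto

text \<open>The probabilistic bound is separated from the plane geometry: it rests on a finite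
  vertex set that no move can leave.\<close>

locale routing_network =
  fixes f :: "point \<Rightarrow> point \<Rightarrow> point set \<Rightarrow> (nat \<Rightarrow> bool) \<Rightarrow> point"
    and V :: "point set" and E :: "point set set" and t :: point
  assumes memoryless: "memoryless_routing f"
    and finite_V: "finite V"
    and nbrs_subset: "v \<in> V \<Longrightarrow> nbrs E v \<subseteq> V"
    and nbrs_nonempty: "v \<in> V \<Longrightarrow> nbrs E v \<noteq> {}"
begin

lemma f_target [simp]: "f t t N B = t"
  using memoryless by (rule memoryless_routing_target)

lemma route_absorbed:
  assumes "route f E s t \<omega> m = t" "m \<le> n"
  shows "route f E s t \<omega> n = t"
  using assms(2)
  by (induction n rule: dec_induct) (simp_all add: assms(1))

lemma step_in_V:
  assumes "v \<in> V"
  shows "f v t (nbrs E v) B \<in> V"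
proof (cases "v = t")
  case False
  have "finite (nbrs E v)"
    using finite_V finite_subset nbrs_subset[OF assms] by blast
  then show ?thesis
    using memoryless_routing_in[OF memoryless _ nbrs_nonempty[OF assms] False] nbrs_subset[OF assms] by blast
qed (use assms in simp)

lemma step_measurable [measurable]: "f v t N \<in> coins \<rightarrow>\<^sub>M count_space UNIV"
  using memoryless by (rule memoryless_routing_measurable)

text \<open>An algorithm is measurable in its coins for each fixed position and neighbourhood. Since
  the route stays in the finite set \<open>V\<close>, every step splits into countably many cases
  according to the position.\<close>

lemma route_measurable:
  assumes "s \<in> V"
  shows "(\<lambda>\<omega>. route f E s t \<omega> n) \<in> coin_seq.S \<rightarrow>\<^sub>M count_space V"
proof (induction n)
  case 0
  show ?case using assms by simp
next
  case (Suc n)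
  have "(\<lambda>\<omega>. f v t (nbrs E v) (\<omega> n)) \<in> coin_seq.S \<rightarrow>\<^sub>M count_space V" if "v \<in> V" for v
    by (rule measurable_count_space_extend[OF subset_UNIV])
      (use step_in_V[OF that] in \<open>auto\<close>)
  then show ?case
    unfolding route.simps
    by (rule measurable_compose_countable'[OF _ Suc])
      (auto intro: countable_finite finite_V)
qed


section \<open>Truncated costs and the number of steps before arrival\<close>

definition truncated_cost :: "real \<Rightarrow> nat \<Rightarrow> point \<Rightarrow> (nat \<Rightarrow> nat \<Rightarrow> bool) \<Rightarrow> ennreal" where
  "truncated_cost m n s \<omega> =
     (\<Sum>j<n. of_bool (route f E s t \<omega> j \<noteq> t)) + ennreal m * of_bool (route f E s t \<omega> n \<noteq> t)"

text \<open>A sum of indicators, hence measurable. As \<open>t\<close> is absorbing, it counts the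
  steps before arrival and can stand in for \<open>num_steps\<close> under the integral.\<close>

definition visits :: "point \<Rightarrow> (nat \<Rightarrow> nat \<Rightarrow> bool) \<Rightarrow> ennreal" where
  "visits s \<omega> = (\<Sum>j. of_bool (route f E s t \<omega> j \<noteq> t))"

lemma indicator_measurable:
  assumes "s \<in> V"
  shows "(\<lambda>\<omega>. of_bool (route f E s t \<omega> n \<noteq> t) :: ennreal) \<in> borel_measurable coin_seq.S"
  by (rule measurable_compose[OF route_measurable[OF assms]]) simp

lemma truncated_cost_measurable:
  assumes "s \<in> V"
  shows "truncated_cost m n s \<in> borel_measurable coin_seq.S"
  unfolding truncated_cost_def[abs_def]
  by (intro borel_measurable_add borel_measurable_sum borel_measurable_times_ennreal borel_measurable_const
      indicator_measurable assms)

lemma visits_measurable: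
  assumes "s \<in> V"
  shows "visits s \<in> borel_measurable coin_seq.S"
  unfolding visits_def[abs_def]
  by (intro borel_measurable_suminf_order indicator_measurable assms)

lemma truncated_cost_case_nat:
  "truncated_cost m (Suc n) s (case_nat b \<omega>) =
     of_bool (s \<noteq> t) + truncated_cost m n (f s t (nbrs E s) b) \<omega>"
  by (simp only: truncated_cost_def sum.lessThan_Suc_shift route_case_nat) (simp add: add.assoc)

text \<open>Fubini for an independent sequence split into its first entry and the rest, which is
  what first-step analysis needs.\<close>

lemma nn_integral_coin_seq:
  assumes [measurable]: "g \<in> borel_measurable coin_seq.S"
  shows "(\<integral>\<^sup>+\<omega>. g \<omega> \<partial>coin_seq.S) = (\<integral>\<^sup>+b. \<integral>\<^sup>+\<omega>. g (case_nat b \<omega>) \<partial>coin_seq.S \<partial>coins)"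
proof -
  have "(\<integral>\<^sup>+\<omega>. g \<omega> \<partial>coin_seq.S) =
      (\<integral>\<^sup>+\<omega>. g \<omega> \<partial>distr (coins \<Otimes>\<^sub>M coin_seq.S) coin_seq.S (\<lambda>(s, \<omega>). case_nat s \<omega>))"
    by (simp only: coin_seq.PiM_iter)
  also have "\<dots> = (\<integral>\<^sup>+x. g (case x of (s, \<omega>) \<Rightarrow> case_nat s \<omega>) \<partial>(coins \<Otimes>\<^sub>M coin_seq.S))"
    by (rule nn_integral_distr) measurable
  also have "\<dots> = (\<integral>\<^sup>+b. \<integral>\<^sup>+\<omega>. g (case_nat b \<omega>) \<partial>coin_seq.S \<partial>coins)"
    by (subst coin_seq.P.nn_integral_fst[symmetric]) (simp_all, measurable?)
  finally show ?thesis .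
qed

lemma visits_le_num_steps: "visits s \<omega> \<le> num_steps f E s t \<omega>"
proof (cases "\<exists>n. route f E s t \<omega> n = t")
  case True
  define T where "T = (LEAST n. route f E s t \<omega> n = t)"
  have T: "route f E s t \<omega> T = t"
    unfolding T_def using True by (rule LeastI_ex)
  have "visits s \<omega> = (\<Sum>j<T. of_bool (route f E s t \<omega> j \<noteq> t))"
    unfolding visits_def
    by (rule suminf_finite) (auto simp: route_absorbed[OF T])
  also have "\<dots> \<le> (\<Sum>j<T. 1)"
    by (rule sum_mono) auto
  finally show ?thesis
    using True by (simp add: num_steps_def T_def ennreal_of_nat_eq_real_of_nat)
qed (simp add: num_steps_def)

text \<open>Either the packet has arrived by time \<open>n\<close> and the final charge vanishes, or
  all of the first \<open>n\<close> steps count and \<open>n + m = (1 + m / n) * n\<close>.\<close>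

lemma truncated_cost_le:
  assumes "m \<ge> 0" "n > 0"
  shows "truncated_cost m n s \<omega> \<le> ennreal (1 + m / real n) * visits s \<omega>"
proof -
  have partial: "(\<Sum>j<n. of_bool (route f E s t \<omega> j \<noteq> t)) \<le> visits s \<omega>"
    unfolding visits_def by (rule sum_le_suminf) auto
  show ?thesis
  proof (cases "route f E s t \<omega> n = t")
    case True
    then have "truncated_cost m n s \<omega> \<le> 1 * visits s \<omega>"
      using partial by (simp add: truncated_cost_def)
    also have "\<dots> \<le> ennreal (1 + m / real n) * visits s \<omega>"
      using assms by (intro mult_right_mono) (auto simp: ennreal_leI simp flip: ennreal_1)
    finally show ?thesis .
  next
    case False
    have "(\<Sum>j<n. of_bool (route f E s t \<omega> j \<noteq> t)) = (\<Sum>j<n. 1 :: ennreal)"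
      by (rule sum.cong) (use False route_absorbed in auto)
    then have sum: "(\<Sum>j<n. of_bool (route f E s t \<omega> j \<noteq> t)) = ennreal (real n)"
      by (simp add: ennreal_of_nat_eq_real_of_nat)
    then have "truncated_cost m n s \<omega> = ennreal (real n) + ennreal m"
      using False by (simp add: truncated_cost_def)
    also have "\<dots> = ennreal (1 + m / real n) * ennreal (real n)"
      using assms by (simp add: field_simps flip: ennreal_plus ennreal_mult)
    also have "\<dots> \<le> ennreal (1 + m / real n) * visits s \<omega>"
      using partial sum by (intro mult_left_mono) auto
    finally show ?thesis .
  qed
qed

text \<open>No optional stopping theorem is needed: the truncated cost charges the maximum of the potential when
  the packet is still under way after \<open>n\<close> steps, and pointwise this exceeds the number of steps
  by a factor of at most \<open>1 + m / n\<close>.\<close>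
theorem expected_steps_ge_potential:
  fixes \<phi> :: "point \<Rightarrow> real"
  assumes target: "\<phi> t = 0"
    and nonneg: "\<And>v. v \<in> V \<Longrightarrow> 0 \<le> \<phi> v"
    and step: "\<And>v. v \<in> V \<Longrightarrow> v \<noteq> t \<Longrightarrow>
      ennreal (\<phi> v) \<le> 1 + (\<integral>\<^sup>+b. ennreal (\<phi> (f v t (nbrs E v) b)) \<partial>coins)"
    and s: "s \<in> V"
  shows "ennreal (\<phi> s) \<le> expected_steps f E s t"
proof -
  define m where "m = Max (\<phi> ` V)"
  have m: "\<phi> v \<le> m" if "v \<in> V" for v
    unfolding m_def using that finite_V by simp
  have "m \<ge> 0"
    using m[OF s] nonneg[OF s] by simp
  \<comment> \<open>The start vertex is generalised in the induction on \<open>n\<close>, because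
    after the first step the remaining route starts at a random neighbour.\<close>
  have cost: "ennreal (\<phi> v) \<le> (\<integral>\<^sup>+\<omega>. truncated_cost m n v \<omega> \<partial>coin_seq.S)" if "v \<in> V" for v n
    using that
  proof (induction n arbitrary: v)
    case 0
    have "ennreal (\<phi> v) \<le> ennreal m * of_bool (v \<noteq> t)"
      using m[OF 0] target by (auto intro: ennreal_leI)
    then show ?case
      by (simp add: truncated_cost_def coin_seq.P.emeasure_space_1)
  next
    case (Suc n)
    show ?case
    proof (cases "v = t")
      case False
      let ?u = "f v t (nbrs E v)"
      have "ennreal (\<phi> v) \<le> 1 + (\<integral>\<^sup>+b. ennreal (\<phi> (?u b)) \<partial>coins)"
        using step[OF Suc.prems False] .
      also have "\<dots> = (\<integral>\<^sup>+b. 1 + ennreal (\<phi> (?u b)) \<partial>coins)"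
        using coin_seq.M.emeasure_space_1
        by (subst nn_integral_add) (auto intro!: measurable_compose[OF step_measurable])
      also have "\<dots> \<le> (\<integral>\<^sup>+b. 1 + (\<integral>\<^sup>+\<omega>. truncated_cost m n (?u b) \<omega> \<partial>coin_seq.S) \<partial>coins)"
        by (intro nn_integral_mono add_left_mono Suc.IH step_in_V Suc.prems)
      also have "\<dots> = (\<integral>\<^sup>+b. \<integral>\<^sup>+\<omega>. truncated_cost m (Suc n) v (case_nat b \<omega>) \<partial>coin_seq.S \<partial>coins)"
        using False coin_seq.P.emeasure_space_1
        by (simp add: truncated_cost_case_nat nn_integral_add truncated_cost_measurable step_in_V Suc.prems)
      also have "\<dots> = (\<integral>\<^sup>+\<omega>. truncated_cost m (Suc n) v \<omega> \<partial>coin_seq.S)"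
        by (rule nn_integral_coin_seq[symmetric, OF truncated_cost_measurable[OF Suc.prems]])
      finally show ?thesis .
    qed (simp add: target)
  qed
  have bound: "ennreal (\<phi> s) \<le> ennreal (1 + m / real n) * expected_steps f E s t" if "n > 0" for n
  proof -
    have "ennreal (\<phi> s) \<le> (\<integral>\<^sup>+\<omega>. truncated_cost m n s \<omega> \<partial>coin_seq.S)"
      by (rule cost[OF s])
    also have "\<dots> \<le> (\<integral>\<^sup>+\<omega>. ennreal (1 + m / real n) * visits s \<omega> \<partial>coin_seq.S)"
      by (intro nn_integral_mono truncated_cost_le \<open>m \<ge> 0\<close> that)
    also have "\<dots> = ennreal (1 + m / real n) * (\<integral>\<^sup>+\<omega>. visits s \<omega> \<partial>coin_seq.S)"
      by (rule nn_integral_cmult[OF visits_measurable[OF s]])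
    also have "\<dots> \<le> ennreal (1 + m / real n) * expected_steps f E s t"
      unfolding expected_steps_def
      by (intro mult_left_mono nn_integral_mono visits_le_num_steps) simp
    finally show ?thesis .
  qed
  show ?thesis
  proof (cases "expected_steps f E s t" rule: ennreal_cases)
    case (real r)
    \<comment> \<open>Letting \<open>n\<close> grow removes the factor
      \<open>1 + m / n\<close>.\<close>
    have "(\<lambda>n. (1 + m / real n) * r) \<longlonglongrightarrow> (1 + 0) * r"
      by (intro tendsto_intros lim_const_over_n)
    moreover have "\<forall>n\<ge>1. \<phi> s \<le> (1 + m / real n) * r"
    proof (intro allI impI)
      fix n :: nat assume "n \<ge> 1"
      have "ennreal (\<phi> s) \<le> ennreal ((1 + m / real n) * r)"
        using bound[of n] \<open>n \<ge> 1\<close> \<open>m \<ge> 0\<close> real by (simp add: ennreal_mult)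
      then show "\<phi> s \<le> (1 + m / real n) * r"
        using \<open>m \<ge> 0\<close> real by (simp add: ennreal_le_iff)
    qed
    ultimately have "\<phi> s \<le> (1 + 0) * r"
      by (intro LIMSEQ_le_const) auto
    then show ?thesis
      using real by (simp add: ennreal_leI)
  qed simp
qed

end

section \<open>Birth-death walks on a subdivided segment\<close>

text \<open>A potential of height \<open>n\<^sup>2\<close> for the walk on \<open>{0..n}\<close> that steps up with probability \<open>p\<close>: it bounds the
  expected time to hit \<open>0\<close>, with the walk reflected at \<open>n\<close>.\<close>
definition climbs :: "(nat \<Rightarrow> real) \<Rightarrow> nat \<Rightarrow> (nat \<Rightarrow> real) \<Rightarrow> bool" where
  "climbs p n \<psi> \<longleftrightarrow> \<psi> 0 = 0 \<and> \<psi> n = (real n)\<^sup>2 \<and> \<psi> n \<le> 1 + \<psi> (n - 1) \<and> (\<forall>i\<le>n. 0 \<le> \<psi> i) \<and>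
     (\<forall>i. 0 < i \<longrightarrow> i < n \<longrightarrow> \<psi> i \<le> 1 + p i * \<psi> (i + 1) + (1 - p i) * \<psi> (i - 1))"

text \<open>\<open>\<delta> i\<close> is the increment from \<open>i\<close> to
  \<open>i + 1\<close>. Shrinking all increments by \<open>r \<le> 1\<close> preserves the
  inequalities, whose only inhomogeneous term is the constant 1, and brings the top down to exactly
  \<open>n\<^sup>2\<close>.\<close>

lemma climbs_of_increments:
  assumes n: "n > 0" and nonneg: "\<And>i. i < n \<Longrightarrow> 0 \<le> \<delta> i" and last: "\<delta> (n - 1) \<le> 1"
    and step: "\<And>i. 0 < i \<Longrightarrow> i < n \<Longrightarrow> (1 - p i) * \<delta> (i - 1) \<le> 1 + p i * \<delta> i"
    and large: "(real n)\<^sup>2 \<le> (\<Sum>i<n. \<delta> i)"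
  shows "\<exists>\<psi>. climbs p n \<psi>"
proof -
  define r where "r = (real n)\<^sup>2 / (\<Sum>i<n. \<delta> i)"
  define \<psi> where "\<psi> i = r * (\<Sum>j<i. \<delta> j)" for i
  have pos: "0 < (real n)\<^sup>2" using n by simp
  then have r: "0 < r" "r \<le> 1" and top: "r * (\<Sum>i<n. \<delta> i) = (real n)\<^sup>2"
    using large unfolding r_def by (auto simp: less_le_trans[OF pos large])
  have Suc: "\<psi> (Suc i) = \<psi> i + r * \<delta> i" for i
    by (simp add: \<psi>_def algebra_simps)
  have "climbs p n \<psi>"
    unfolding climbs_def
  proof (intro conjI allI impI)
    show "\<psi> 0 = 0" "\<psi> n = (real n)\<^sup>2"
      by (simp_all add: \<psi>_def top)
    have "r * \<delta> (n - 1) \<le> 1"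
      using mult_left_mono[OF last, of r] r by linarith
    then show "\<psi> n \<le> 1 + \<psi> (n - 1)"
      using Suc[of "n - 1"] n by simp
    show "0 \<le> \<psi> i" if "i \<le> n" for i
      unfolding \<psi>_def using nonneg that r by (intro mult_nonneg_nonneg sum_nonneg) auto
    fix i assume i: "0 < i" "i < n"
    have "r * ((1 - p i) * \<delta> (i - 1)) \<le> r * (1 + p i * \<delta> i)"
      using step[OF i] r by (intro mult_left_mono) auto
    also have "\<dots> \<le> 1 + r * (p i * \<delta> i)"
      using r by (simp add: algebra_simps)
    finally have "r * ((1 - p i) * \<delta> (i - 1)) \<le> 1 + r * (p i * \<delta> i)" .
    moreover have "\<psi> i = \<psi> (i - 1) + r * \<delta> (i - 1)"
      using Suc[of "i - 1"] i by simp
    ultimately show "\<psi> i \<le> 1 + p i * \<psi> (i + 1) + (1 - p i) * \<psi> (i - 1)"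
      using Suc[of i] by (simp add: algebra_simps)
  qed
  then show ?thesis by blast
qed

text \<open>At \<open>m\<close> the walk never steps down, so the potential may jump by the full
  \<open>n\<^sup>2\<close> between \<open>m - 1\<close> and \<open>m\<close> and be constant
  elsewhere.\<close>

lemma climbs_one_way:
  assumes "0 < m" "m < n" "p m = 1"
    and p: "\<And>i. 0 < i \<Longrightarrow> i < n \<Longrightarrow> 0 \<le> p i"
  shows "\<exists>\<psi>. climbs p n \<psi>"
proof (rule climbs_of_increments)
  let ?\<delta> = "\<lambda>i. if i = m - 1 then (real n)\<^sup>2 else 0"
  show "(1 - p i) * ?\<delta> (i - 1) \<le> 1 + p i * ?\<delta> i" if "0 < i" "i < n" for i
  proof (cases "i - 1 = m - 1")
    case True
    then have "i = m" using that \<open>0 < m\<close> by simp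
    then show ?thesis using \<open>p m = 1\<close> by simp
  qed (use p[OF that] in simp)
qed (use assms in auto)

text \<open>Cauchy-Schwarz for the vectors \<open>sqrt (c i)\<close> and
  \<open>1 / sqrt (c i)\<close>.\<close>

lemma card_sq_le_sum_mult_sum_inverse:
  fixes c :: "'a \<Rightarrow> real"
  assumes "\<And>i. i \<in> I \<Longrightarrow> 0 < c i"
  shows "(real (card I))\<^sup>2 \<le> (\<Sum>i\<in>I. c i) * (\<Sum>i\<in>I. 1 / c i)"
proof -
  have "(\<Sum>i\<in>I. sqrt (c i) * (1 / sqrt (c i)))\<^sup>2 \<le> (\<Sum>i\<in>I. (sqrt (c i))\<^sup>2) * (\<Sum>i\<in>I. (1 / sqrt (c i))\<^sup>2)"
    by (rule Cauchy_Schwarz_ineq_sum)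
  also have "(\<Sum>i\<in>I. sqrt (c i) * (1 / sqrt (c i))) = (\<Sum>i\<in>I. 1)"
    by (rule sum.cong) (auto dest: assms)
  also have "(\<Sum>i\<in>I. (sqrt (c i))\<^sup>2) = (\<Sum>i\<in>I. c i)"
    by (rule sum.cong) (auto dest: assms)
  also have "(\<Sum>i\<in>I. (1 / sqrt (c i))\<^sup>2) = (\<Sum>i\<in>I. 1 / c i)"
    by (rule sum.cong) (auto dest: assms simp: power_divide)
  finally show ?thesis by simp
qed

text \<open>Read from the other end, position \<open>i\<close> becomes \<open>n - i\<close> and a
  step up becomes a step down, whence \<open>1 - p (n - i)\<close>. Before rescaling, the two
  hitting times sum up to the commute time, which is at least \<open>2 * n\<^sup>2\<close>, so one
  of them is large enough.\<close>

lemma climbs_either_way: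
  assumes n: "n > 0" and p: "\<And>i. 0 < i \<Longrightarrow> i < n \<Longrightarrow> 0 \<le> p i \<and> p i \<le> 1"
  shows "(\<exists>\<psi>. climbs p n \<psi>) \<or> (\<exists>\<psi>. climbs (\<lambda>i. 1 - p (n - i)) n \<psi>)"
\<comment> \<open>Forced moves are treated apart, because the odds \<open>p j / (1 - p j)\<close>
  used below have to be positive and finite.\<close>
proof (cases "\<exists>m. 0 < m \<and> m < n \<and> (p m = 0 \<or> p m = 1)")
  case True
  then obtain m where m: "0 < m" "m < n" "p m = 0 \<or> p m = 1" by blast
  from m(3) show ?thesis
  proof
    assume "p m = 0"
    then show ?thesis
      using m p by (intro disjI2 climbs_one_way[of "n - m"]) auto
  next
    assume "p m = 1"
    then show ?thesis
      using m p by (intro disjI1 climbs_one_way[of m]) auto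
  qed
next
  case False
  then have p01: "0 < p i" "p i < 1" if "0 < i" "i < n" for i
    using p[OF that] that by (metis order_le_less)+
  \<comment> \<open>The \<open>c i\<close> are the conductances of the reversible walk; \<open>\<delta>\<close> and \<open>\<epsilon>\<close> are the increments of the hitting
    times of the two ends, and their total is the commute time.\<close>
  define c where "c i = (\<Prod>j\<in>{1..i}. p j / (1 - p j))" for i
  have c_pos: "0 < c i" if "i < n" for i
    unfolding c_def using p01 that by (intro prod_pos) auto
  \<comment> \<open>Detailed balance at \<open>i\<close>, where \<open>c i\<close> belongs to the
    edge between \<open>i\<close> and \<open>i + 1\<close>.\<close>
  have balance: "(1 - p i) * c i = p i * c (i - 1)" if "0 < i" "i < n" for i
  proof -
    have "c i = c (i - 1) * (p i / (1 - p i))"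
      using that by (cases i) (simp_all add: c_def)
    then show ?thesis
      using p01[OF that] by simp
  qed
  define S where "S = (\<Sum>j<n. c j)"
  \<comment> \<open>\<open>L i\<close> and \<open>U i\<close> are the total conductances below and
    above the edge between \<open>i\<close> and \<open>i + 1\<close>.\<close>
  define L where "L i = (\<Sum>j<i. c j)" for i
  define U where "U i = S - L (Suc i)" for i
  have U_nonneg: "0 \<le> U i" if "i < n" for i
    using that unfolding U_def S_def L_def
    by (simp del: sum.lessThan_Suc, intro sum_mono2) (auto intro: less_imp_le[OF c_pos])
  have L_nonneg: "0 \<le> L i" if "i < n" for i
    unfolding L_def using that by (intro sum_nonneg) (auto intro: less_imp_le[OF c_pos])
  \<comment> \<open>Mean time to cross this edge downwards: its conductance plus twice everything
    beyond it, divided by its conductance. \<open>\<epsilon>\<close> is the analogue for upward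
    crossings, indexed from the other end.\<close>
  define \<delta> where "\<delta> i = (c i + 2 * U i) / c i" for i
  define \<epsilon> where "\<epsilon> i = (c (n - 1 - i) + 2 * L (n - 1 - i)) / c (n - 1 - i)" for i
  have "(\<Sum>i<n. \<epsilon> i) = (\<Sum>i<n. (c i + 2 * L i) / c i)"
    unfolding \<epsilon>_def by (rule sum.reindex_bij_witness[of _ "\<lambda>i. n - 1 - i" "\<lambda>i. n - 1 - i"]) auto
  then have "(\<Sum>i<n. \<delta> i) + (\<Sum>i<n. \<epsilon> i) = (\<Sum>i<n. (c i + 2 * U i) / c i + (c i + 2 * L i) / c i)"
    by (simp add: sum.distrib \<delta>_def)
  \<comment> \<open>Since \<open>L i + c i + U i = S\<close>, one crossing in each direction costs
    \<open>2 * S / c i\<close>.\<close>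
  also have "\<dots> = (\<Sum>i<n. 2 * S * (1 / c i))"
    by (rule sum.cong) (simp_all add: U_def L_def flip: add_divide_distrib)
  also have "\<dots> = 2 * (S * (\<Sum>i<n. 1 / c i))"
    by (simp add: sum_distrib_left)
  finally have "2 * (real n)\<^sup>2 \<le> (\<Sum>i<n. \<delta> i) + (\<Sum>i<n. \<epsilon> i)"
    using card_sq_le_sum_mult_sum_inverse[of "{..<n}" c] c_pos by (simp add: S_def)
  then consider "(real n)\<^sup>2 \<le> (\<Sum>i<n. \<delta> i)" | "(real n)\<^sup>2 \<le> (\<Sum>i<n. \<epsilon> i)"
    by linarith
  then show ?thesis
  proof cases
    case 1
    have "\<exists>\<psi>. climbs p n \<psi>"
    proof (rule climbs_of_increments[OF n _ _ _ 1])
      show "0 \<le> \<delta> i" if "i < n" for i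
        unfolding \<delta>_def using c_pos[OF that] U_nonneg[OF that] by simp
      show "\<delta> (n - 1) \<le> 1"
        using n c_pos[of "n - 1"] by (simp add: \<delta>_def U_def L_def S_def del: sum.lessThan_Suc)
      fix i assume i: "0 < i" "i < n"
      then have pos: "0 < c (i - 1)" "0 < c i"
        using c_pos by simp_all
      have U: "U (i - 1) = U i + c i"
        using i by (simp add: U_def L_def)
      have "(1 - p i) / c (i - 1) = p i / c i"
        using balance[OF i] pos by (subst frac_eq_eq) simp_all
      moreover have "(1 - p i) * \<delta> (i - 1) = 1 - p i + 2 * ((1 - p i) / c (i - 1)) * U (i - 1)"
        using pos by (simp add: \<delta>_def field_simps)
      ultimately have "(1 - p i) * \<delta> (i - 1) = 1 - p i + 2 * (p i / c i) * (U i + c i)"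
        using U by simp
      also have "\<dots> = 1 + p i * \<delta> i"
        using pos by (simp add: \<delta>_def field_simps)
      finally show "(1 - p i) * \<delta> (i - 1) \<le> 1 + p i * \<delta> i" by simp
    qed
    then show ?thesis ..
  next
    case 2
    have "\<exists>\<psi>. climbs (\<lambda>i. 1 - p (n - i)) n \<psi>"
    proof (rule climbs_of_increments[OF n _ _ _ 2])
      show "0 \<le> \<epsilon> i" if "i < n" for i
        unfolding \<epsilon>_def using c_pos[of "n - 1 - i"] L_nonneg[of "n - 1 - i"] n by simp
      show "\<epsilon> (n - 1) \<le> 1"
        by (simp add: \<epsilon>_def L_def)
      fix i assume i: "0 < i" "i < n"
      \<comment> \<open>\<open>m\<close> is the same position counted from the other end: going up
        from \<open>i\<close> means going down from \<open>m\<close>.\<close>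
      define m where "m = n - i"
      have m: "0 < m" "m < n" "n - 1 - (i - 1) = m" "n - 1 - i = m - 1"
        using i by (auto simp: m_def)
      have pos: "0 < c (m - 1)" "0 < c m"
        using c_pos m by simp_all
      have L: "L m = L (m - 1) + c (m - 1)"
        using m by (cases m) (auto simp: L_def)
      have "p m / c m = (1 - p m) / c (m - 1)"
        using balance[OF m(1,2)] pos by (subst frac_eq_eq) simp_all
      moreover have "p m * \<epsilon> (i - 1) = p m + 2 * (p m / c m) * L m"
        using pos unfolding \<epsilon>_def m(3) by (simp add: field_simps)
      ultimately have "p m * \<epsilon> (i - 1) = p m + 2 * ((1 - p m) / c (m - 1)) * (L (m - 1) + c (m - 1))"
        using L by simp
      also have "\<dots> = 1 + (1 - p m) * \<epsilon> i"
        using pos unfolding \<epsilon>_def m(4) by (simp add: field_simps)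
      finally show "(1 - (1 - p (n - i))) * \<epsilon> (i - 1) \<le> 1 + (1 - p (n - i)) * \<epsilon> i"
        by (simp add: m_def)
    qed
    then show ?thesis ..
  qed
qed

section \<open>Chains of points on a segment and their drift\<close>

definition chain_pt :: "nat \<Rightarrow> point \<Rightarrow> point \<Rightarrow> nat \<Rightarrow> point" where
  "chain_pt n a b i = a + (real i / real n) *\<^sub>R (b - a)"

definition hop_prob ::
  "(point \<Rightarrow> point \<Rightarrow> point set \<Rightarrow> (nat \<Rightarrow> bool) \<Rightarrow> point) \<Rightarrow> point \<Rightarrow> point \<Rightarrow> point set \<Rightarrow> point \<Rightarrow> real" where
  "hop_prob f t v N u = measure coins {B \<in> space coins. f v t N B = u}"

text \<open>The neighbourhood is fixed to the two adjacent chain points. Hence the probability, and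
  with it the drift, depends on the segment, \<open>n\<close> and \<open>t\<close> alone and is
  known before any graph has been chosen.\<close>

definition forward_prob ::
  "(point \<Rightarrow> point \<Rightarrow> point set \<Rightarrow> (nat \<Rightarrow> bool) \<Rightarrow> point) \<Rightarrow> point \<Rightarrow> nat \<Rightarrow> point \<Rightarrow> point \<Rightarrow> nat \<Rightarrow> real" where
  "forward_prob f t n a b i =
     hop_prob f t (chain_pt n a b i) {chain_pt n a b (i - 1), chain_pt n a b (i + 1)} (chain_pt n a b (i + 1))"

text \<open>The packet drifts from \<open>a\<close> to \<open>b\<close>: a packet at \<open>b\<close> that can leave only along the segment needs
  at least \<open>n\<^sup>2\<close> expected steps to get to \<open>a\<close>, whatever the algorithm does at \<open>b\<close>.\<close>
definition drift ::
  "(point \<Rightarrow> point \<Rightarrow> point set \<Rightarrow> (nat \<Rightarrow> bool) \<Rightarrow> point) \<Rightarrow> point \<Rightarrow> nat \<Rightarrow> point \<Rightarrow> point \<Rightarrow> bool" where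
  "drift f t n a b \<longleftrightarrow> (\<exists>\<psi>. climbs (forward_prob f t n a b) n \<psi>)"

lemma chain_pt_0 [simp]: "chain_pt n a b 0 = a"
  and chain_pt_n [simp]: "n > 0 \<Longrightarrow> chain_pt n a b n = b"
  by (simp_all add: chain_pt_def)

lemma chain_pt_flip: "n > 0 \<Longrightarrow> i \<le> n \<Longrightarrow> chain_pt n b a i = chain_pt n a b (n - i)"
proof -
  assume "n > 0" "i \<le> n"
  then have "real (n - i) / real n = 1 - real i / real n"
    by (simp add: of_nat_diff field_simps)
  moreover have "b + c *\<^sub>R (a - b) = a + (1 - c) *\<^sub>R (b - a)" for c
    by (simp add: algebra_simps)
  ultimately show ?thesis
    unfolding chain_pt_def by presburger
qed

lemma chain_pt_eq_iff [simp]: "n > 0 \<Longrightarrow> a \<noteq> b \<Longrightarrow> chain_pt n a b i = chain_pt n a b j \<longleftrightarrow> i = j"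
  by (simp add: chain_pt_def)

lemma chain_pt_conv: "chain_pt n a b i = (1 - real i / real n) *\<^sub>R a + (real i / real n) *\<^sub>R b"
proof -
  have "a + c *\<^sub>R (b - a) = (1 - c) *\<^sub>R a + c *\<^sub>R b" for c
    by (simp add: algebra_simps)
  then show ?thesis unfolding chain_pt_def .
qed

lemma chain_pt_in_open_segment: "0 < i \<Longrightarrow> i < n \<Longrightarrow> a \<noteq> b \<Longrightarrow> chain_pt n a b i \<in> open_segment a b"
  unfolding in_segment chain_pt_conv by (intro conjI exI[of _ "real i / real n"]) simp_all

lemma chain_pt_in_closed_segment: "n > 0 \<Longrightarrow> i \<le> n \<Longrightarrow> chain_pt n a b i \<in> closed_segment a b"
  unfolding in_segment chain_pt_conv by (intro exI[of _ "real i / real n"]) simp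

lemma hop_prob_add:
  assumes "memoryless_routing f" "v \<noteq> t" "y \<noteq> z"
  shows "hop_prob f t v {y, z} y + hop_prob f t v {y, z} z = 1"
proof -
  have [measurable]: "f v t {y, z} \<in> coins \<rightarrow>\<^sub>M count_space UNIV"
    and "f v t {y, z} B \<in> {y, z}" for B
    using assms(1,2) by (simp_all only: memoryless_routing_measurable memoryless_routing_in finite.intros insert_not_empty not_False_eq_True simp_thms)
  then have "{B \<in> space coins. f v t {y, z} B = y} \<union> {B \<in> space coins. f v t {y, z} B = z} = space coins"
    by blast
  moreover have "{B \<in> space coins. f v t {y, z} B = y} \<inter> {B \<in> space coins. f v t {y, z} B = z} = {}"
    using \<open>y \<noteq> z\<close> by auto
  ultimately show ?thesis
    unfolding hop_prob_def
    by (subst coin_seq.M.finite_measure_Union[symmetric]) (auto simp: coin_seq.M.prob_space)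
qed

lemma nn_integral_hop:
  fixes \<phi> :: "point \<Rightarrow> real"
  assumes "memoryless_routing f" "v \<noteq> t" "y \<noteq> z" "0 \<le> \<phi> y" "0 \<le> \<phi> z"
  shows "(\<integral>\<^sup>+B. ennreal (\<phi> (f v t {y, z} B)) \<partial>coins) =
    ennreal (hop_prob f t v {y, z} y * \<phi> y + hop_prob f t v {y, z} z * \<phi> z)"
proof -
  have [measurable]: "f v t {y, z} \<in> coins \<rightarrow>\<^sub>M count_space UNIV"
    and N: "f v t {y, z} B \<in> {y, z}" for B
    using assms(1,2) by (simp_all only: memoryless_routing_measurable memoryless_routing_in finite.intros insert_not_empty not_False_eq_True simp_thms)
  let ?A = "\<lambda>u. {B \<in> space coins. f v t {y, z} B = u}"
  have "(\<integral>\<^sup>+B. ennreal (\<phi> (f v t {y, z} B)) \<partial>coins) =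
      (\<integral>\<^sup>+B. ennreal (\<phi> y) * indicator (?A y) B + ennreal (\<phi> z) * indicator (?A z) B \<partial>coins)"
    using N \<open>y \<noteq> z\<close> by (intro nn_integral_cong) (auto simp: indicator_def split: if_splits)
  also have "\<dots> = ennreal (\<phi> y) * emeasure coins (?A y) + ennreal (\<phi> z) * emeasure coins (?A z)"
    by (subst nn_integral_add) (auto simp: nn_integral_cmult)
  finally show ?thesis
    using assms by (simp add: hop_prob_def coin_seq.M.emeasure_eq_measure mult.commute flip: ennreal_mult ennreal_plus)
qed

text \<open>At an interior point the packet is not at \<open>t\<close> and must move, so its two hop
  probabilities sum up to 1. Reversing the chain therefore turns the walk into the one covered by
  \<open>climbs_either_way\<close>.\<close>

lemma drift_either_way:
  assumes f: "memoryless_routing f" and n: "n > 0" and "a \<noteq> b" and t: "t \<notin> open_segment a b"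
  shows "drift f t n a b \<or> drift f t n b a"
proof -
  have range: "0 \<le> forward_prob f t n a b i \<and> forward_prob f t n a b i \<le> 1" for i
    by (simp add: forward_prob_def hop_prob_def)
  have "forward_prob f t n b a i = 1 - forward_prob f t n a b (n - i)" if i: "0 < i" "i < n" for i
  proof -
    have *: "chain_pt n b a i = chain_pt n a b (n - i)"
        "chain_pt n b a (i - 1) = chain_pt n a b (n - i + 1)"
        "chain_pt n b a (i + 1) = chain_pt n a b (n - i - 1)"
      using i by (subst chain_pt_flip; simp add: Suc_diff_le)+
    have "chain_pt n a b (n - i) \<noteq> t"
      using chain_pt_in_open_segment[of "n - i" n a b] i \<open>a \<noteq> b\<close> t by auto
    moreover have "chain_pt n a b (n - i - 1) \<noteq> chain_pt n a b (n - i + 1)"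
      using \<open>a \<noteq> b\<close> n by (subst chain_pt_eq_iff) auto
    ultimately have "hop_prob f t (chain_pt n a b (n - i)) {chain_pt n a b (n - i - 1), chain_pt n a b (n - i + 1)} (chain_pt n a b (n - i - 1))
        + hop_prob f t (chain_pt n a b (n - i)) {chain_pt n a b (n - i - 1), chain_pt n a b (n - i + 1)} (chain_pt n a b (n - i + 1)) = 1"
      by (rule hop_prob_add[OF f])
    then show ?thesis
      unfolding forward_prob_def * by (simp add: insert_commute)
  qed
  \<comment> \<open>\<open>climbs\<close> reads the probabilities at interior indices only, and
    there both functions agree.\<close>
  then have "climbs (\<lambda>i. 1 - forward_prob f t n a b (n - i)) n \<psi> \<longleftrightarrow> climbs (forward_prob f t n b a) n \<psi>" for \<psi>
    by (auto simp: climbs_def)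
  then show ?thesis
    using climbs_either_way[OF n, of "forward_prob f t n a b"] range unfolding drift_def by blast
qed

section \<open>Constructing convex subdivisions\<close>

lemma seg_pair [simp]: "seg {a, b} = closed_segment a b"
  by (auto simp: seg_def closed_segment_commute)

lemma convex_polygonD:
  assumes "convex_polygon P"
  shows "convex P" "compact P" "bounded P" "interior P \<noteq> {}"
  using assms finite_imp_compact_convex_hull compact_imp_bounded
  unfolding convex_polygon_def by auto

lemma convex_polygon_triangle: "\<not> collinear {a, b, c :: point} \<Longrightarrow> convex_polygon (convex hull {a, b, c})"
  unfolding convex_polygon_def
  by (intro conjI exI[of _ "{a, b, c}"])
    (auto simp: collinear_3_eq_affine_dependent interior_convex_hull_eq_empty)

text \<open>Disjoint nonempty connected open sets that fill the complement of the skeleton are its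
  components.\<close>

lemma faces_tiling:
  assumes polygon: "\<And>T. T \<in> \<T> \<Longrightarrow> convex_polygon T"
    and disj: "\<And>S T. S \<in> \<T> \<Longrightarrow> T \<in> \<T> \<Longrightarrow> S \<noteq> T \<Longrightarrow> interior S \<inter> interior T = {}"
    and outer: "convex_polygon (\<Union>\<T>)"
    and skeleton: "V \<union> (\<Union>e\<in>E. seg e) = (\<Union>T\<in>\<T>. frontier T)"
  shows "faces V E = insert (- \<Union>\<T>) (interior ` \<T>)"
  unfolding faces_def skeleton
proof (rule components_open_unique)
  show "pairwise disjnt (insert (- \<Union>\<T>) (interior ` \<T>))"
    unfolding pairwise_def disjnt_def using disj interior_subset by fastforce
  show "open X \<and> connected X \<and> X \<noteq> {}" if "X \<in> insert (- \<Union>\<T>) (interior ` \<T>)" for X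
  proof -
    have "\<Union>\<T> \<noteq> UNIV"
      using convex_polygonD(3)[OF outer] not_bounded_UNIV by metis
    then have "open (- \<Union>\<T>) \<and> connected (- \<Union>\<T>) \<and> - \<Union>\<T> \<noteq> {}"
      using convex_polygonD[OF outer] connected_complement_bounded_convex[of "\<Union>\<T>"]
      by (auto simp: compact_imp_closed)
    moreover have "open (interior T) \<and> connected (interior T) \<and> interior T \<noteq> {}" if "T \<in> \<T>" for T
      using convex_polygonD[OF polygon[OF that]] by (simp add: convex_connected)
    ultimately show ?thesis
      using that by blast
  qed
  have sub: "frontier T \<subseteq> T" if "T \<in> \<T>" for T
    using convex_polygonD[OF polygon[OF that]] by (simp add: compact_imp_closed frontier_subset_closed)
  \<comment> \<open>The frontier of a convex tile lies in the closure of its interior, so an open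
    set disjoint from that interior misses the frontier too.\<close>
  have avoid: "interior S \<inter> frontier T = {}" if "S \<in> \<T>" "T \<in> \<T>" for S T
  proof (cases "S = T")
    case False
    have "frontier T \<subseteq> closure (interior T)"
      using convex_polygonD[OF polygon[OF that(2)]] by (auto simp: convex_closure_interior frontier_def)
    moreover have "interior S \<inter> closure (interior T) = {}"
      using disj[OF that False] by (simp add: open_Int_closure_eq_empty)
    ultimately show ?thesis by blast
  qed (simp add: frontier_def)
  show "\<Union> (insert (- \<Union>\<T>) (interior ` \<T>)) = UNIV - (\<Union>T\<in>\<T>. frontier T)"
  proof (intro equalityI subsetI)
    fix p assume "p \<in> \<Union> (insert (- \<Union>\<T>) (interior ` \<T>))"
    then show "p \<in> UNIV - (\<Union>T\<in>\<T>. frontier T)"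
      using sub avoid by blast
  next
    fix p assume p: "p \<in> UNIV - (\<Union>T\<in>\<T>. frontier T)"
    have "p \<in> interior T" if "p \<in> T" "T \<in> \<T>" for T
      using p that closure_subset[of T] by (auto simp: frontier_def)
    then show "p \<in> \<Union> (insert (- \<Union>\<T>) (interior ` \<T>))"
      by blast
  qed
qed

lemma convex_subdivision_tiling:
  assumes "plane_geometric_graph V E"
    and polygon: "\<And>T. T \<in> \<T> \<Longrightarrow> convex_polygon T"
    and disj: "\<And>S T. S \<in> \<T> \<Longrightarrow> T \<in> \<T> \<Longrightarrow> S \<noteq> T \<Longrightarrow> interior S \<inter> interior T = {}"
    and outer: "convex_polygon (\<Union>\<T>)"
    and skeleton: "V \<union> (\<Union>e\<in>E. seg e) = (\<Union>T\<in>\<T>. frontier T)"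
  shows "convex_subdivision V E"
proof -
  have "\<not> bounded (- \<Union>\<T>)"
    using convex_polygonD(3)[OF outer] cobounded_imp_unbounded by auto
  moreover have "bounded (interior T)" if "T \<in> \<T>" for T
    using convex_polygonD(3)[OF polygon[OF that]] bounded_interior by blast
  ultimately have "(bounded F \<longrightarrow> (\<exists>P. convex_polygon P \<and> F = interior P)) \<and>
      (\<not> bounded F \<longrightarrow> (\<exists>P. convex_polygon P \<and> F = - P))" if "F \<in> faces V E" for F
    using that polygon outer unfolding faces_tiling[OF polygon disj outer skeleton, simplified]
    by (elim insertE imageE) metis+
  then show ?thesis
    using assms(1) by (simp add: convex_subdivision_def)
qed

text \<open>With the edges in a list, each unordered pair is tested once, and only for the
  nontrivial inclusion.\<close>

lemma plane_geometric_graphI: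
  assumes "finite V"
    and ends: "\<And>a b. (a, b) \<in> set es \<Longrightarrow> a \<in> V \<and> b \<in> V \<and> a \<noteq> b"
    and cross: "sorted_wrt (\<lambda>(a, b) (c, d). closed_segment a b \<inter> closed_segment c d \<subseteq> {a, b} \<inter> {c, d}) es"
    and vert: "\<And>v a b. v \<in> V \<Longrightarrow> (a, b) \<in> set es \<Longrightarrow> v \<in> closed_segment a b \<Longrightarrow> v \<in> {a, b}"
    and E: "E = (\<lambda>(a, b). {a, b}) ` set es"
  shows "plane_geometric_graph V E"
proof -
  have E_iff: "e \<in> E \<longleftrightarrow> (\<exists>a b. (a, b) \<in> set es \<and> e = {a, b})" for e
    unfolding E by force
  have geo: "geometric_graph V E"
    unfolding geometric_graph_def
  proof (intro conjI ballI assms(1))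
    fix e assume "e \<in> E"
    then obtain a b where "(a, b) \<in> set es" "e = {a, b}"
      unfolding E_iff by metis
    then show "\<exists>u v. e = {u, v} \<and> u \<noteq> v \<and> u \<in> V \<and> v \<in> V"
      using ends by metis
  qed
  have ordered: "closed_segment a b \<inter> closed_segment c d \<subseteq> {a, b} \<inter> {c, d}"
    if "es ! i = (a, b)" "es ! j = (c, d)" "i < j" "j < length es" for a b c d i j
    using sorted_wrt_nth_less[OF cross that(3,4)] that(1,2) by simp
  have pair: "closed_segment a b \<inter> closed_segment c d = {a, b} \<inter> {c, d}"
    if ab: "(a, b) \<in> set es" and cd: "(c, d) \<in> set es" and ne: "{a, b} \<noteq> {c, d}" for a b c d
  proof
    obtain i j where i: "es ! i = (a, b)" "i < length es" and j: "es ! j = (c, d)" "j < length es"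
      using ab cd by (metis in_set_conv_nth)
    have "i \<noteq> j"
      using i(1) j(1) ne by auto
    then consider "i < j" | "j < i" by linarith
    then show "closed_segment a b \<inter> closed_segment c d \<subseteq> {a, b} \<inter> {c, d}"
    proof cases
      case 1
      show ?thesis using ordered[OF i(1) j(1) 1 j(2)] .
    next
      case 2
      show ?thesis using ordered[OF j(1) i(1) 2 i(2)] by (simp only: Int_commute)
    qed
  qed auto
  show ?thesis
    unfolding plane_geometric_graph_def
  proof (intro conjI ballI impI geo)
    fix e1 e2 assume "e1 \<in> E" "e2 \<in> E" "e1 \<noteq> e2"
    then obtain a b c d where "(a, b) \<in> set es" "e1 = {a, b}" "(c, d) \<in> set es" "e2 = {c, d}"
      unfolding E_iff by metis
    then show "seg e1 \<inter> seg e2 = e1 \<inter> e2"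
      using pair[of a b c d] \<open>e1 \<noteq> e2\<close> by simp
  next
    fix v e assume "v \<in> V" "e \<in> E" "v \<in> seg e"
    then obtain a b where "(a, b) \<in> set es" "e = {a, b}"
      unfolding E_iff by metis
    then show "v \<in> e"
      using vert[of v a b] \<open>v \<in> V\<close> \<open>v \<in> seg e\<close> by simp
  qed
qed

lemma convex_subdivision_triangle:
  fixes a b c :: point
  assumes nc: "\<not> collinear {a, b, c}"
  shows "convex_subdivision {a, b, c} {{a, b}, {b, c}, {c, a}}"
proof (rule convex_subdivision_tiling[where \<T> = "{convex hull {a, b, c}}"])
  have ne: "a \<noteq> b" "b \<noteq> c" "c \<noteq> a"
    using nc unfolding collinear_3_eq_affine_dependent by blast+
  have meet: "closed_segment a b \<inter> closed_segment b c = {b}"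
      "closed_segment b c \<inter> closed_segment c a = {c}"
      "closed_segment c a \<inter> closed_segment a b = {a}"
    using nc by (intro Int_closed_segment disjI2; simp add: insert_commute)+
  have far: "a \<notin> closed_segment b c" "b \<notin> closed_segment c a" "c \<notin> closed_segment a b"
    using meet ne by (metis IntI ends_in_segment singletonD)+
  show "plane_geometric_graph {a, b, c} {{a, b}, {b, c}, {c, a}}"
  proof (rule plane_geometric_graphI[where es = "[(a, b), (b, c), (c, a)]"])
    show "sorted_wrt (\<lambda>(a, b) (c, d). closed_segment a b \<inter> closed_segment c d \<subseteq> {a, b} \<inter> {c, d})
        [(a, b), (b, c), (c, a)]"
      using meet by (simp add: Int_commute)
  qed (use ne far in auto)
  show "{a, b, c} \<union> (\<Union>e\<in>{{a, b}, {b, c}, {c, a}}. seg e) = (\<Union>T\<in>{convex hull {a, b, c}}. frontier T)"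
    by (auto simp: frontier_of_triangle)
  show "convex_polygon T" if "T \<in> {convex hull {a, b, c}}" for T
    using convex_polygon_triangle[OF nc] that by simp
  show "convex_polygon (\<Union>{convex hull {a, b, c}})"
    using convex_polygon_triangle[OF nc] by simp
qed auto

text \<open>The union of the drawn edges does not change, so neither do the faces; what has to be
  rechecked is planarity.\<close>

lemma convex_subdivision_insert_vertex:
  assumes cs: "convex_subdivision V E" and ab: "{a, b} \<in> E" and x: "x \<in> open_segment a b"
  shows "convex_subdivision (insert x V) (insert {a, x} (insert {x, b} (E - {{a, b}})))"
    (is "convex_subdivision ?V ?E")
proof -
  have finite: "finite V" and edges: "\<And>e. e \<in> E \<Longrightarrow> \<exists>u v. e = {u, v} \<and> u \<noteq> v \<and> u \<in> V \<and> v \<in> V"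
    and cross: "\<And>e1 e2. e1 \<in> E \<Longrightarrow> e2 \<in> E \<Longrightarrow> e1 \<noteq> e2 \<Longrightarrow> seg e1 \<inter> seg e2 = e1 \<inter> e2"
    and vert: "\<And>v e. v \<in> V \<Longrightarrow> e \<in> E \<Longrightarrow> v \<in> seg e \<Longrightarrow> v \<in> e"
    using cs unfolding convex_subdivision_def plane_geometric_graph_def geometric_graph_def by blast+
  have abV: "a \<in> V" "b \<in> V" "a \<noteq> b"
    using edges[OF ab] by (auto simp: doubleton_eq_iff)
  have xab: "x \<noteq> a" "x \<noteq> b" "x \<in> closed_segment a b"
    using x by (auto simp: open_segment_def)
  have xV: "x \<notin> V"
    using vert[OF _ ab] xab by auto
  have split: "closed_segment a x \<union> closed_segment x b = closed_segment a b"
    "closed_segment a x \<inter> closed_segment x b = {x}"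
    using xab by (auto intro!: Un_closed_segment Int_closed_segment)
  have ends: "b \<notin> closed_segment a x" "a \<notin> closed_segment x b"
    using split(2) xab by (metis IntI ends_in_segment singletonD)+
  have x_seg: "x \<notin> seg e" if "e \<in> E" "e \<noteq> {a, b}" for e
    using cross[OF ab that(1)] that(2) xab by auto
  have x_edge: "x \<notin> e" if "e \<in> E" for e
    using edges[OF that] xV by auto
  have left: "closed_segment a x \<inter> seg e = {a, x} \<inter> e"
    and right: "closed_segment x b \<inter> seg e = {x, b} \<inter> e" if "e \<in> E" "e \<noteq> {a, b}" for e
  proof -
    have "closed_segment a b \<inter> seg e = {a, b} \<inter> e"
      using cross[OF ab that(1)] that(2) by auto
    then show "closed_segment a x \<inter> seg e = {a, x} \<inter> e" "closed_segment x b \<inter> seg e = {x, b} \<inter> e"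
      using split ends x_seg[OF that] x_edge[OF that(1)] by auto
  qed
  have geo: "geometric_graph ?V ?E"
    unfolding geometric_graph_def
  proof (intro conjI ballI)
    show "\<exists>u v. e = {u, v} \<and> u \<noteq> v \<and> u \<in> ?V \<and> v \<in> ?V" if "e \<in> ?E" for e
      using that edges[of e] abV xab by blast
  qed (use finite in simp)
  have "plane_geometric_graph ?V ?E"
    unfolding plane_geometric_graph_def
  proof (intro conjI ballI impI)
    fix e1 e2 assume "e1 \<in> ?E" "e2 \<in> ?E" "e1 \<noteq> e2"
    then have "e1 = {a, x} \<or> e1 = {x, b} \<or> e1 \<in> E \<and> e1 \<noteq> {a, b}"
      "e2 = {a, x} \<or> e2 = {x, b} \<or> e2 \<in> E \<and> e2 \<noteq> {a, b}"
      by simp_all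
    with \<open>e1 \<noteq> e2\<close> consider "e1 \<in> E" "e2 \<in> E" | "e1 = {a, x}" "e2 = {x, b}" | "e2 = {a, x}" "e1 = {x, b}"
      | "e1 = {a, x}" "e2 \<in> E" "e2 \<noteq> {a, b}" | "e1 = {x, b}" "e2 \<in> E" "e2 \<noteq> {a, b}"
      | "e2 = {a, x}" "e1 \<in> E" "e1 \<noteq> {a, b}" | "e2 = {x, b}" "e1 \<in> E" "e1 \<noteq> {a, b}"
      by metis
    then show "seg e1 \<inter> seg e2 = e1 \<inter> e2"
    proof cases
      case 1 then show ?thesis using cross \<open>e1 \<noteq> e2\<close> by blast
    next
      case 2 then show ?thesis using split(2) abV xab by auto
    next
      case 3 then show ?thesis using split(2) abV xab by auto
    next
      case 4 then show ?thesis using left by simp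
    next
      case 5 then show ?thesis using right by simp
    next
      case 6 then show ?thesis using left[of e1] by (simp add: Int_commute)
    next
      case 7 then show ?thesis using right[of e1] by (simp add: Int_commute)
    qed
  next
    fix v e assume v: "v \<in> ?V" and e: "e \<in> ?E" and ve: "v \<in> seg e"
    have new: "v \<in> {a, b, x}" if "v \<in> closed_segment a x \<union> closed_segment x b"
    proof -
      have "v \<in> seg {a, b}" using that split(1) by simp
      then show ?thesis using vert[OF _ ab] v by blast
    qed
    consider "e \<in> E" "e \<noteq> {a, b}" | "e = {a, x}" | "e = {x, b}"
      using e by (simp only: insert_iff Diff_iff singleton_iff) metis
    then show "v \<in> e"
    proof cases
      case 1
      then show ?thesis using v ve vert x_seg by blast
    next
      case 2
      then have "v \<in> closed_segment a x" using ve by simp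
      then show ?thesis using new ends 2 by blast
    next
      case 3
      then have "v \<in> closed_segment x b" using ve by simp
      then show ?thesis using new ends 3 by blast
    qed
  qed (rule geo)
  moreover have "V \<union> (\<Union>e\<in>E. seg e) = ?V \<union> (\<Union>e\<in>?E. seg e)"
  proof -
    have "(\<Union>e\<in>E. seg e) = (\<Union>e\<in>insert {a, b} (E - {{a, b}}). seg e)"
      by (simp only: insert_Diff[OF ab])
    then have "(\<Union>e\<in>E. seg e) = closed_segment a b \<union> (\<Union>e\<in>E - {{a, b}}. seg e)"
      by (simp only: UN_insert seg_pair)
    moreover have "V \<union> (S \<union> R) = insert x V \<union> (A \<union> (B \<union> R))" if "A \<union> B = S" "x \<in> A" for S A B R
      unfolding that(1)[symmetric] using that(2) by (simp add: insert_absorb Un_ac)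
    from this[OF split(1) ends_in_segment(2)] have
      "V \<union> (closed_segment a b \<union> (\<Union>e\<in>E - {{a, b}}. seg e)) = ?V \<union> (\<Union>e\<in>?E. seg e)"
      unfolding UN_insert seg_pair .
    ultimately show ?thesis
      by (rule trans[OF arg_cong[where f = "(\<union>) V"]])
  qed
  then have "faces ?V ?E = faces V E"
    by (simp add: faces_def)
  ultimately show ?thesis
    using cs by (simp add: convex_subdivision_def)
qed

section \<open>Replacing edges by chains\<close>

definition chain_edges :: "nat \<Rightarrow> point \<Rightarrow> point \<Rightarrow> point set set" where
  "chain_edges n a b = (\<lambda>i. {chain_pt n a b i, chain_pt n a b (Suc i)}) ` {..<n}"

lemma convex_subdivision_edge:
  assumes "convex_subdivision V E" "{a, b} \<in> E"
  shows "a \<in> V" "b \<in> V" "a \<noteq> b"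
proof -
  have "\<exists>u v. e = {u, v} \<and> u \<noteq> v \<and> u \<in> V \<and> v \<in> V" if "e \<in> E" for e
    using assms(1) that unfolding convex_subdivision_def plane_geometric_graph_def geometric_graph_def by blast
  from this[OF assms(2)] obtain u v where "{a, b} = {u, v}" "u \<noteq> v" "u \<in> V" "v \<in> V"
    by blast
  then show "a \<in> V" "b \<in> V" "a \<noteq> b"
    by (auto simp: doubleton_eq_iff)
qed

lemma convex_subdivision_vertex_on_edge:
  assumes "convex_subdivision V E" "v \<in> V" "{a, b} \<in> E" "v \<in> closed_segment a b"
  shows "v \<in> {a, b}"
proof -
  have "v \<in> seg e \<Longrightarrow> v \<in> e" if "e \<in> E" for e
    using assms(1,2) that unfolding convex_subdivision_def plane_geometric_graph_def by blast
  from this[OF assms(3)] show ?thesis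
    using assms(4) by simp
qed

lemma convex_subdivision_crossing:
  assumes "convex_subdivision V E" "{a, b} \<in> E" "{c, d} \<in> E" "{a, b} \<noteq> {c, d}"
  shows "closed_segment a b \<inter> closed_segment c d = {a, b} \<inter> {c, d}"
proof -
  have "seg e \<inter> seg e' = e \<inter> e'" if "e \<in> E" "e' \<in> E" "e \<noteq> e'" for e e'
    using assms(1) that unfolding convex_subdivision_def plane_geometric_graph_def by blast
  from this[OF assms(2-4)] show ?thesis
    by simp
qed

lemma chain_pt_notin:
  assumes cs: "convex_subdivision V E" and ab: "{a, b} \<in> E" and i: "0 < i" "i < n"
  shows "chain_pt n a b i \<notin> V"
proof -
  have "chain_pt n a b i \<in> open_segment a b"
    using i convex_subdivision_edge[OF cs ab] by (intro chain_pt_in_open_segment)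
  then show ?thesis
    using convex_subdivision_vertex_on_edge[OF cs _ ab] by (auto simp: open_segment_def)
qed

text \<open>This lets a chain be built from \<open>a\<close> towards \<open>b\<close> by splitting
  the last piece repeatedly; \<open>1 / (n - i)\<close> is the share of one step in what
  remains.\<close>

lemma chain_pt_Suc_between:
  assumes "Suc i < n" "a \<noteq> b"
  shows "chain_pt n a b (Suc i) \<in> open_segment (chain_pt n a b i) b"
proof -
  let ?u = "1 / real (n - i)"
  have *: "(real n - real i) * ?u = 1"
    using assms by (simp add: of_nat_diff)
  have "real (Suc i) / real n = (1 - ?u) * (real i / real n) + ?u"
    using assms * by (simp add: divide_simps of_nat_diff) (simp add: algebra_simps)
  then have "chain_pt n a b (Suc i) = (1 - ?u) *\<^sub>R chain_pt n a b i + ?u *\<^sub>R b"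
    unfolding chain_pt_def by (simp only:) (simp add: algebra_simps)
  moreover have "chain_pt n a b i \<noteq> chain_pt n a b n"
    using assms by (subst chain_pt_eq_iff) auto
  ultimately show ?thesis
    unfolding in_segment using assms by (intro conjI exI[of _ ?u]) auto
qed

text \<open>The points are inserted one by one on the remaining edge from the latest point to
  \<open>b\<close>. After \<open>n - 1\<close> insertions this edge is the last chain edge.\<close>

lemma convex_subdivision_chain:
  assumes cs: "convex_subdivision V E" and ab: "{a, b} \<in> E" and n: "n > 0"
  shows "convex_subdivision (V \<union> chain_pt n a b ` {..n}) (E - {{a, b}} \<union> chain_edges n a b)"
proof -
  let ?x = "chain_pt n a b"
  note V = convex_subdivision_edge[OF cs ab]
  have "convex_subdivision (V \<union> ?x ` {..m}) (E - {{a, b}} \<union> (\<lambda>i. {?x i, ?x (Suc i)}) ` {..<m} \<union> {{?x m, b}})"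
    if "m < n" for m
    using that
  proof (induction m)
    case 0
    then show ?case
      using cs ab V by (simp add: insert_absorb insert_Diff_single)
  next
    case (Suc m)
    let ?E = "E - {{a, b}} \<union> (\<lambda>i. {?x i, ?x (Suc i)}) ` {..<m}"
    \<comment> \<open>The edge to be split must differ from all others, so that deleting it leaves
      exactly \<open>?E\<close>.\<close>
    have "{?x m, b} \<notin> E - {{a, b}}"
    proof (cases "m = 0")
      case False
      then have "?x m \<notin> V"
        using chain_pt_notin[OF cs ab, of m n] Suc.prems by simp
      then show ?thesis
        using convex_subdivision_edge[OF cs] by blast
    qed simp
    moreover have "{?x m, b} \<noteq> {?x i, ?x (Suc i)}" if "i < m" for i
    proof -
      have "?x n \<noteq> ?x i" "?x n \<noteq> ?x (Suc i)"
        using that Suc.prems V by (subst chain_pt_eq_iff; simp)+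
      then show ?thesis
        using n by (auto simp: doubleton_eq_iff)
    qed
    ultimately have "{?x m, b} \<notin> ?E"
      by blast
    then have E: "?E \<union> {{?x m, b}} - {{?x m, b}} = ?E"
      by blast
    have "convex_subdivision (insert (?x (Suc m)) (V \<union> ?x ` {..m}))
      (insert {?x m, ?x (Suc m)} (insert {?x (Suc m), b} (?E \<union> {{?x m, b}} - {{?x m, b}})))"
      using Suc chain_pt_Suc_between[of m n a b] V by (intro convex_subdivision_insert_vertex) auto
    then show ?case
      unfolding E by (simp add: atMost_Suc lessThan_Suc Un_assoc insert_commute)
  qed
  from this[of "n - 1"] have "convex_subdivision (V \<union> ?x ` {..n - 1})
      (E - {{a, b}} \<union> (\<lambda>i. {?x i, ?x (Suc i)}) ` {..<n - 1} \<union> {{?x (n - 1), ?x n}})"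
    using n by simp
  moreover have "{..<n} = insert (n - 1) {..<n - 1}" "{..n} = insert n {..n - 1}"
    using n by auto
  then have "chain_edges n a b = (\<lambda>i. {?x i, ?x (Suc i)}) ` {..<n - 1} \<union> {{?x (n - 1), ?x n}}"
    and "V \<union> ?x ` {..n} = V \<union> ?x ` {..n - 1}"
    using n V by (auto simp: chain_edges_def)
  ultimately show ?thesis
    by (simp add: Un_assoc)
qed

text \<open>The pairs in \<open>C\<close> are ordered because a chain is numbered from its first end
  to its second.\<close>

definition subdiv_vertices :: "nat \<Rightarrow> point set \<Rightarrow> (point \<times> point) set \<Rightarrow> point set" where
  "subdiv_vertices n V C = V \<union> (\<Union>(a, b)\<in>C. chain_pt n a b ` {..n})"

definition subdiv_edges :: "nat \<Rightarrow> point set set \<Rightarrow> (point \<times> point) set \<Rightarrow> point set set" where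
  "subdiv_edges n E C = (E - (\<lambda>(a, b). {a, b}) ` C) \<union> (\<Union>(a, b)\<in>C. chain_edges n a b)"

lemma convex_subdivision_subdivide:
  assumes cs: "convex_subdivision V E" and n: "n > 0" and "finite C"
    and CE: "\<And>a b. (a, b) \<in> C \<Longrightarrow> {a, b} \<in> E"
    and inj: "\<And>a b. (a, b) \<in> C \<Longrightarrow> (b, a) \<notin> C"
  shows "convex_subdivision (subdiv_vertices n V C) (subdiv_edges n E C)"
  using \<open>finite C\<close> CE inj
proof (induction C rule: finite_induct)
  case empty
  then show ?case
    using cs by (simp add: subdiv_vertices_def subdiv_edges_def)
next
  case (insert e C)
  obtain a b where e: "e = (a, b)" by fastforce
  have ab: "{a, b} \<in> E" and CE: "\<And>a b. (a, b) \<in> C \<Longrightarrow> {a, b} \<in> E"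
    using insert.prems(1) e by blast+
  have fresh: "{a, b} \<noteq> {c, d}" if "(c, d) \<in> C" for c d
    using insert.hyps(2) insert.prems(2)[of a b] that unfolding e by (metis doubleton_eq_iff insertCI)
  \<comment> \<open>Both ends of such a chain edge would be old vertices, so the chain would consist
    of the single edge \<open>{c, d}\<close>, which differs from \<open>{a, b}\<close>.\<close>
  have "{a, b} \<notin> chain_edges n c d" if cd: "(c, d) \<in> C" for c d
  proof
    assume "{a, b} \<in> chain_edges n c d"
    then obtain i where i: "i < n" "{a, b} = {chain_pt n c d i, chain_pt n c d (Suc i)}"
      by (auto simp: chain_edges_def)
    then have "chain_pt n c d i \<in> V" "chain_pt n c d (Suc i) \<in> V"
      using convex_subdivision_edge[OF cs ab] by auto
    then have "i = 0" "Suc i = n"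
      using chain_pt_notin[OF cs CE[OF cd], of i n] chain_pt_notin[OF cs CE[OF cd], of "Suc i" n] i(1)
      by (metis gr0I, metis Suc_lessI zero_less_Suc)
    then show False
      using i fresh[OF cd] n by (metis chain_pt_0 chain_pt_n)
  qed
  then have "{a, b} \<notin> (\<Union>(a, b)\<in>C. chain_edges n a b)"
    by auto
  moreover have "{a, b} \<notin> (\<lambda>(a, b). {a, b}) ` C"
    using fresh by auto
  moreover have "convex_subdivision (subdiv_vertices n V C) (subdiv_edges n E C)"
    by (intro insert.IH) (use insert.prems in blast)+
  ultimately have "convex_subdivision (subdiv_vertices n V C \<union> chain_pt n a b ` {..n})
      (subdiv_edges n E C - {{a, b}} \<union> chain_edges n a b)"
    using ab n by (intro convex_subdivision_chain) (auto simp: subdiv_edges_def)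
  moreover have "subdiv_vertices n V C \<union> chain_pt n a b ` {..n} = subdiv_vertices n V (insert e C)"
    by (auto simp: subdiv_vertices_def e)
  moreover have "subdiv_edges n E C - {{a, b}} \<union> chain_edges n a b = subdiv_edges n E (insert e C)"
    using \<open>{a, b} \<notin> (\<Union>(a, b)\<in>C. chain_edges n a b)\<close> by (auto simp: subdiv_edges_def e)
  ultimately show ?case
    by simp
qed

section \<open>Traps\<close>

text \<open>The base graphs have at most 7 vertices and 12 edges, and each edge becomes at most
  \<open>k + 1\<close> points; \<open>7 + 12 * (k + 1) \<le> 31 * k\<close> for positive
  \<open>k\<close>.\<close>

definition has_slow_instance :: "(point \<Rightarrow> point \<Rightarrow> point set \<Rightarrow> (nat \<Rightarrow> bool) \<Rightarrow> point) \<Rightarrow> nat \<Rightarrow> bool" where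
  "has_slow_instance f k \<longleftrightarrow> (\<exists>V E s t. convex_subdivision V E \<and> s \<in> V \<and> t \<in> V \<and>
     k \<le> card V \<and> card V \<le> 31 * k \<and> ennreal ((real k)\<^sup>2) \<le> expected_steps f E s t)"

text \<open>The edges between \<open>S\<close> and its complement get subdivided. Each becomes a
  barrier of height \<open>n\<^sup>2\<close> for a packet that leaves \<open>S\<close>, as it must
  to reach \<open>t\<close>.\<close>

locale trap =
  fixes f :: "point \<Rightarrow> point \<Rightarrow> point set \<Rightarrow> (nat \<Rightarrow> bool) \<Rightarrow> point"
    and V S :: "point set" and E :: "point set set" and t :: point and n :: nat
  assumes memoryless: "memoryless_routing f"
    and n_pos: "n > 0"
    and subdivision: "convex_subdivision V E"
    and no_isolated: "V \<subseteq> \<Union>E"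
    and t_in_V: "t \<in> V"
    and S_subset: "S \<subseteq> V" and t_notin_S: "t \<notin> S"
    and drift_into_S: "\<And>a b. {a, b} \<in> E \<Longrightarrow> a \<notin> S \<Longrightarrow> b \<in> S \<Longrightarrow> drift f t n a b"
begin

definition C :: "(point \<times> point) set" where
  "C = {(a, b). {a, b} \<in> E \<and> a \<notin> S \<and> b \<in> S}"

lemma C_D:
  assumes "(a, b) \<in> C"
  shows "{a, b} \<in> E" "a \<notin> S" "b \<in> S" "a \<in> V" "b \<in> V" "a \<noteq> b" "drift f t n a b" "(b, a) \<notin> C"
  using assms drift_into_S convex_subdivision_edge[OF subdivision] unfolding C_def by auto

lemma finite_base: "finite V"
  using subdivision by (simp add: convex_subdivision_def plane_geometric_graph_def geometric_graph_def)

lemma finite_E: "finite E"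
proof (rule finite_subset)
  show "E \<subseteq> Pow V"
    using subdivision
    unfolding convex_subdivision_def plane_geometric_graph_def geometric_graph_def by fast
qed (simp add: finite_base)

lemma inj_C: "inj_on (\<lambda>(a, b). {a, b}) C"
  by (rule inj_onI) (auto simp: doubleton_eq_iff dest: C_D)

lemma C_image: "(\<lambda>(a, b). {a, b}) ` C \<subseteq> E"
  using C_D(1) by auto

lemma finite_C: "finite C"
  using inj_C C_image finite_E by (rule inj_on_finite)

lemma card_C: "card C \<le> card E"
  using inj_C C_image finite_E by (rule card_inj_on_le)

abbreviation "V' \<equiv> subdiv_vertices n V C"
abbreviation "E' \<equiv> subdiv_edges n E C"

lemma subdivision': "convex_subdivision V' E'"
  by (rule convex_subdivision_subdivide[OF subdivision n_pos finite_C]) (rule C_D, assumption)+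

lemma V_subset: "V \<subseteq> V'"
  by (simp add: subdiv_vertices_def)

lemma chain_pt_notin_V: "(a, b) \<in> C \<Longrightarrow> 0 < i \<Longrightarrow> i < n \<Longrightarrow> chain_pt n a b i \<notin> V"
  by (rule chain_pt_notin[OF subdivision C_D(1)])

lemma V'_cases:
  assumes "v \<in> V'"
  obtains "v \<in> V" | a b i where "(a, b) \<in> C" "0 < i" "i < n" "v = chain_pt n a b i"
proof (cases "v \<in> V")
  case False
  then obtain a b i where "(a, b) \<in> C" "i \<le> n" "v = chain_pt n a b i"
    using assms by (auto simp: subdiv_vertices_def)
  moreover from this have "i \<noteq> 0" "i \<noteq> n"
    using False n_pos C_D(4,5)[of a b] by (metis chain_pt_0, metis chain_pt_n)
  ultimately show ?thesis
    using that(2) by auto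
qed

lemma E'_cases:
  assumes "{u, v} \<in> E'"
  obtains "{u, v} \<in> E" "{u, v} \<notin> (\<lambda>(a, b). {a, b}) ` C"
  | a b i where "(a, b) \<in> C" "i < n" "u = chain_pt n a b i" "v = chain_pt n a b (Suc i)"
  | a b i where "(a, b) \<in> C" "i < n" "v = chain_pt n a b i" "u = chain_pt n a b (Suc i)"
proof -
  consider "{u, v} \<in> E" "{u, v} \<notin> (\<lambda>(a, b). {a, b}) ` C"
    | a b where "(a, b) \<in> C" "{u, v} \<in> chain_edges n a b"
    using assms unfolding subdiv_edges_def by auto
  then show ?thesis
  proof cases
    case 1
    then show ?thesis by (rule that(1))
  next
    case (2 a b)
    then obtain i where "i < n" "{u, v} = {chain_pt n a b i, chain_pt n a b (Suc i)}"
      unfolding chain_edges_def by auto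
    then consider "u = chain_pt n a b i" "v = chain_pt n a b (Suc i)"
      | "u = chain_pt n a b (Suc i)" "v = chain_pt n a b i"
      unfolding doubleton_eq_iff by blast
    then show ?thesis
    proof cases
      case 1
      then show ?thesis by (rule that(2)[OF 2(1) \<open>i < n\<close>])
    next
      case 2
      then show ?thesis by (intro that(3)[OF \<open>(a, b) \<in> C\<close> \<open>i < n\<close>])
    qed
  qed
qed

lemma chain_edge_in_E': "(a, b) \<in> C \<Longrightarrow> i < n \<Longrightarrow> {chain_pt n a b i, chain_pt n a b (Suc i)} \<in> E'"
  unfolding subdiv_edges_def chain_edges_def
  by (rule UnI2, rule UN_I[of "(a, b)"], assumption, unfold case_prod_conv, rule imageI, simp)

text \<open>Distinct edges of a plane graph meet only in common ends, and the orientation is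
  determined by the end that lies in \<open>S\<close>.\<close>

lemma chain_pt_unique:
  assumes ab: "(a, b) \<in> C" and cd: "(c, d) \<in> C" and i: "0 < i" "i < n" and j: "j \<le> n"
    and eq: "chain_pt n a b i = chain_pt n c d j"
  shows "c = a \<and> d = b \<and> j = i"
proof -
  have "chain_pt n a b i \<in> open_segment a b"
    using C_D(6)[OF ab] i by (intro chain_pt_in_open_segment)
  then have x: "chain_pt n a b i \<in> closed_segment a b" "chain_pt n a b i \<notin> {a, b}"
    by (auto simp: open_segment_def)
  have "chain_pt n a b i \<in> closed_segment c d"
    unfolding eq using n_pos j by (rule chain_pt_in_closed_segment)
  then have "{a, b} = {c, d}"
    using x convex_subdivision_crossing[OF subdivision C_D(1)[OF ab] C_D(1)[OF cd]] by auto
  then have "a = c" "b = d"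
    using C_D(2,3)[OF ab] C_D(2,3)[OF cd] by (auto simp: doubleton_eq_iff)
  then show ?thesis
    using eq n_pos C_D(6)[OF ab] by simp
qed

text \<open>This is the neighbourhood presupposed in \<open>forward_prob\<close>, so the drift of
  the isolated segment describes the packet in the subdivided graph.\<close>

lemma nbrs_chain:
  assumes ab: "(a, b) \<in> C" and i: "0 < i" "i < n"
  shows "nbrs E' (chain_pt n a b i) = {chain_pt n a b (i - 1), chain_pt n a b (i + 1)}"
proof (intro equalityI subsetI)
  fix u assume "u \<in> nbrs E' (chain_pt n a b i)"
  then have "{u, chain_pt n a b i} \<in> E'"
    by (simp add: nbrs_def)
  then show "u \<in> {chain_pt n a b (i - 1), chain_pt n a b (i + 1)}"
  proof (cases rule: E'_cases)
    case 1
    then have "chain_pt n a b i \<in> V"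
      using convex_subdivision_edge(2)[OF subdivision] by blast
    then show ?thesis
      using chain_pt_notin_V[OF ab i] by blast
  next
    case (2 c d j)
    then have "c = a \<and> d = b \<and> Suc j = i"
      using chain_pt_unique[OF ab 2(1) i, of "Suc j"] by simp
    then show ?thesis using 2 by auto
  next
    case (3 c d j)
    then have "c = a \<and> d = b \<and> j = i"
      using chain_pt_unique[OF ab 3(1) i, of j] by simp
    then show ?thesis using 3 by auto
  qed
next
  fix u assume "u \<in> {chain_pt n a b (i - 1), chain_pt n a b (i + 1)}"
  then show "u \<in> nbrs E' (chain_pt n a b i)"
    using chain_edge_in_E'[OF ab, of i] chain_edge_in_E'[OF ab, of "i - 1"] i
    by (auto simp: nbrs_def insert_commute)
qed

lemma nbrs_V':
  assumes "v \<in> V'"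
  shows "nbrs E' v \<subseteq> V'" "nbrs E' v \<noteq> {}"
proof -
  show "nbrs E' v \<subseteq> V'"
    using convex_subdivision_edge(1)[OF subdivision'] by (auto simp: nbrs_def)
  show "nbrs E' v \<noteq> {}"
    using assms
  proof (cases rule: V'_cases)
    case 1
    then obtain e where e: "e \<in> E" "v \<in> e"
      using no_isolated by blast
    moreover have "\<exists>u w. e = {u, w}"
      using subdivision \<open>e \<in> E\<close>
      unfolding convex_subdivision_def plane_geometric_graph_def geometric_graph_def by meson
    ultimately obtain u where u: "{u, v} \<in> E"
      by (metis doubleton_eq_iff insertE singletonD)
    consider "{u, v} \<in> E'" | a b where "(a, b) \<in> C" "{u, v} = {a, b}"
    proof (cases "{u, v} \<in> (\<lambda>(a, b). {a, b}) ` C")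
      case True
      then obtain a b where "(a, b) \<in> C" "{u, v} = {a, b}" by auto
      then show ?thesis by (rule that(2))
    next
      case False
      then have "{u, v} \<in> E'"
        using u unfolding subdiv_edges_def by blast
      then show ?thesis by (rule that(1))
    qed
    then show ?thesis
    proof cases
      case (2 a b)
      then consider "v = a" | "v = b" by (auto simp: doubleton_eq_iff)
      then show ?thesis
      proof cases
        case 1
        then have "{chain_pt n a b 1, v} \<in> E'"
          using chain_edge_in_E'[OF 2(1) n_pos] by (simp add: insert_commute)
        then show ?thesis by (auto simp: nbrs_def)
      next
        case 2
        then have "{chain_pt n a b (n - 1), v} \<in> E'"
          using chain_edge_in_E'[OF \<open>(a, b) \<in> C\<close>, of "n - 1"] n_pos by simp
        then show ?thesis by (auto simp: nbrs_def)
      qed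
    qed (auto simp: nbrs_def)
  next
    case (2 a b i)
    then show ?thesis by (simp add: nbrs_chain)
  qed
qed

sublocale routing_network f V' E' t
proof
  show "finite V'"
    using subdivision' by (simp add: convex_subdivision_def plane_geometric_graph_def geometric_graph_def)
qed (use memoryless nbrs_V' in auto)

section \<open>The potential of a trap\<close>

definition \<psi> :: "point \<Rightarrow> point \<Rightarrow> nat \<Rightarrow> real" where
  "\<psi> a b = (SOME g. climbs (forward_prob f t n a b) n g)"

lemma climbs_\<psi>: "(a, b) \<in> C \<Longrightarrow> climbs (forward_prob f t n a b) n (\<psi> a b)"
  using C_D(7) unfolding \<psi>_def drift_def by (rule someI_ex)

text \<open>The pieces fit together since \<open>climbs\<close> prescribes the values at both ends
  of a chain; the value chosen by \<open>THE\<close> is unique by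
  \<open>chain_pt_unique\<close>.\<close>

definition \<phi> :: "point \<Rightarrow> real" where
  "\<phi> v = (if v \<in> S then (real n)\<^sup>2
     else if \<exists>a b i. (a, b) \<in> C \<and> 0 < i \<and> i < n \<and> v = chain_pt n a b i
     then THE r. \<exists>a b i. (a, b) \<in> C \<and> 0 < i \<and> i < n \<and> v = chain_pt n a b i \<and> r = \<psi> a b i
     else 0)"

lemma \<phi>_S: "v \<in> S \<Longrightarrow> \<phi> v = (real n)\<^sup>2"
  by (simp add: \<phi>_def)

lemma \<phi>_outside: "v \<in> V \<Longrightarrow> v \<notin> S \<Longrightarrow> \<phi> v = 0"
  using chain_pt_notin_V by (auto simp: \<phi>_def)

lemma \<phi>_chain:
  assumes ab: "(a, b) \<in> C" and "i \<le> n"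
  shows "\<phi> (chain_pt n a b i) = \<psi> a b i"
proof -
  have \<psi>: "\<psi> a b 0 = 0" "\<psi> a b n = (real n)\<^sup>2"
    using climbs_\<psi>[OF ab] by (simp_all add: climbs_def)
  consider "i = 0" | "i = n" | "0 < i" "i < n"
    using \<open>i \<le> n\<close> by linarith
  then show ?thesis
  proof cases
    case 1
    then show ?thesis using \<psi> \<phi>_outside C_D(2,4)[OF ab] by simp
  next
    case 2
    then show ?thesis using \<psi> \<phi>_S C_D(3)[OF ab] n_pos by simp
  next
    case 3
    have "chain_pt n a b i \<notin> S"
      using chain_pt_notin_V[OF ab 3] S_subset by blast
    moreover have "(THE r. \<exists>c d j. (c, d) \<in> C \<and> 0 < j \<and> j < n \<and> chain_pt n a b i = chain_pt n c d j \<and> r = \<psi> c d j) = \<psi> a b i"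
    proof (rule the_equality)
      show "\<exists>c d j. (c, d) \<in> C \<and> 0 < j \<and> j < n \<and> chain_pt n a b i = chain_pt n c d j \<and> \<psi> a b i = \<psi> c d j"
        using ab 3 by blast
      fix r assume "\<exists>c d j. (c, d) \<in> C \<and> 0 < j \<and> j < n \<and> chain_pt n a b i = chain_pt n c d j \<and> r = \<psi> c d j"
      then obtain c d j where "(c, d) \<in> C" "j < n" "chain_pt n a b i = chain_pt n c d j" "r = \<psi> c d j"
        by blast
      then show "r = \<psi> a b i"
        using chain_pt_unique[OF ab _ 3, of c d j] by simp
    qed
    ultimately show ?thesis
      unfolding \<phi>_def using ab 3 by auto
  qed
qed

lemma \<phi>_nonneg:
  assumes "v \<in> V'"
  shows "0 \<le> \<phi> v"
  using assms
proof (cases rule: V'_cases)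
  case 1
  then show ?thesis using \<phi>_S \<phi>_outside by (cases "v \<in> S") simp_all
next
  case (2 a b i)
  then show ?thesis using climbs_\<psi>[OF 2(1)] \<phi>_chain[OF 2(1), of i] by (simp add: climbs_def)
qed

text \<open>By the condition of \<open>climbs\<close> at the top of a chain, one step out of
  \<open>S\<close> loses at most 1. Hence the potential inequality holds on \<open>S\<close>
  whatever the algorithm does there.\<close>

lemma \<phi>_nbrs_S:
  assumes v: "v \<in> S" and u: "u \<in> nbrs E' v"
  shows "(real n)\<^sup>2 - 1 \<le> \<phi> u"
proof -
  have "v \<in> V" using v S_subset by blast
  have "{u, v} \<in> E'" using u by (simp add: nbrs_def)
  then show ?thesis
  proof (cases rule: E'_cases)
    case 1
    then have "(u, v) \<notin> C" by force
    then have "u \<in> S" using 1(1) v by (simp add: C_def)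
    then show ?thesis by (simp add: \<phi>_S)
  next
    case (2 a b i)
    then have "Suc i = n"
      using chain_pt_notin_V[OF 2(1), of "Suc i"] \<open>v \<in> V\<close> by (metis Suc_lessI zero_less_Suc)
    then have "i = n - 1" by simp
    then show ?thesis
      using 2 \<phi>_chain[OF 2(1), of i] climbs_\<psi>[OF 2(1)] by (simp add: climbs_def)
  next
    \<comment> \<open>This case is contradictory: \<open>v\<close> would be the end of a chain that
      lies outside \<open>S\<close>.\<close>
    case (3 a b i)
    then have "i = 0"
      using chain_pt_notin_V[OF 3(1), of i] \<open>v \<in> V\<close> by (metis gr0I)
    then show ?thesis
      using 3 v C_D(2) by simp
  qed
qed

lemma \<phi>_step:
  assumes v: "v \<in> V'" and "v \<noteq> t"
  shows "ennreal (\<phi> v) \<le> 1 + (\<integral>\<^sup>+B. ennreal (\<phi> (f v t (nbrs E' v) B)) \<partial>coins)"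
  using v
proof (cases rule: V'_cases)
  case 1
  show ?thesis
  proof (cases "v \<in> S")
    case True
    have "f v t (nbrs E' v) B \<in> nbrs E' v" for B
      using memoryless_routing_in[OF memoryless _ nbrs_V'(2)[OF v] \<open>v \<noteq> t\<close>]
        finite_subset[OF nbrs_V'(1)[OF v] finite_V] .
    then have "ennreal ((real n)\<^sup>2 - 1) \<le> ennreal (\<phi> (f v t (nbrs E' v) B))" for B
      using \<phi>_nbrs_S[OF True] by (intro ennreal_leI) blast
    then have "(\<integral>\<^sup>+B. ennreal ((real n)\<^sup>2 - 1) \<partial>coins) \<le> (\<integral>\<^sup>+B. ennreal (\<phi> (f v t (nbrs E' v) B)) \<partial>coins)"
      by (rule nn_integral_mono)
    then have "1 + ennreal ((real n)\<^sup>2 - 1) \<le> 1 + (\<integral>\<^sup>+B. ennreal (\<phi> (f v t (nbrs E' v) B)) \<partial>coins)"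
      by (intro add_left_mono) (simp add: coin_seq.M.emeasure_space_1)
    moreover have "1 + ennreal ((real n)\<^sup>2 - 1) = ennreal (1 + ((real n)\<^sup>2 - 1))"
      using n_pos by (subst ennreal_plus) (simp_all add: one_le_power)
    ultimately show ?thesis
      by (simp add: \<phi>_S[OF True])
  qed (simp add: \<phi>_outside 1)
next
  case (2 a b i)
  let ?x = "chain_pt n a b"
  let ?p = "forward_prob f t n a b i"
  have i: "i - 1 \<le> n" "i + 1 \<le> n" and ne: "?x (i - 1) \<noteq> ?x (i + 1)"
    using 2 n_pos C_D(6)[OF 2(1)] by auto
  have nonneg: "0 \<le> \<phi> (?x (i - 1))" "0 \<le> \<phi> (?x (i + 1))"
    using i climbs_\<psi>[OF 2(1)] by (simp_all add: \<phi>_chain[OF 2(1)] climbs_def)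
  have xt: "?x i \<noteq> t"
    using 2 \<open>v \<noteq> t\<close> by simp
  have "hop_prob f t (?x i) {?x (i - 1), ?x (i + 1)} (?x (i - 1)) = 1 - ?p"
    using hop_prob_add[OF memoryless xt ne] by (simp add: forward_prob_def)
  then have "(\<integral>\<^sup>+B. ennreal (\<phi> (f v t (nbrs E' v) B)) \<partial>coins) =
      ennreal ((1 - ?p) * \<phi> (?x (i - 1)) + ?p * \<phi> (?x (i + 1)))"
    unfolding 2(4) nbrs_chain[OF 2(1-3)] nn_integral_hop[where \<phi> = \<phi>, OF memoryless xt ne nonneg]
    by (simp add: forward_prob_def)
  moreover have "0 \<le> ?p" "?p \<le> 1"
    by (simp_all add: forward_prob_def hop_prob_def)
  moreover have "\<phi> v \<le> 1 + ((1 - ?p) * \<phi> (?x (i - 1)) + ?p * \<phi> (?x (i + 1)))"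
    using climbs_\<psi>[OF 2(1)] 2 i by (simp add: \<phi>_chain[OF 2(1)] climbs_def algebra_simps)
  ultimately show ?thesis
    using nonneg by (simp add: ennreal_leI flip: ennreal_1 ennreal_plus)
qed

lemma expected_steps_trap:
  assumes "s \<in> S"
  shows "ennreal ((real n)\<^sup>2) \<le> expected_steps f E' s t"
proof -
  have "ennreal (\<phi> s) \<le> expected_steps f E' s t"
  proof (rule expected_steps_ge_potential)
    show "\<phi> t = 0"
      using t_in_V t_notin_S by (rule \<phi>_outside)
    show "s \<in> V'"
      using assms S_subset V_subset by blast
  qed (use \<phi>_nonneg \<phi>_step in auto)
  then show ?thesis
    by (simp add: \<phi>_S[OF assms])
qed

lemma card_V'_le: "card V' \<le> card V + card E * (n + 1)"
proof -
  have "card (\<Union>(a, b)\<in>C. chain_pt n a b ` {..n}) \<le> (\<Sum>p\<in>C. card (case p of (a, b) \<Rightarrow> chain_pt n a b ` {..n}))"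
    using finite_C by (rule card_UN_le)
  also have "\<dots> \<le> (\<Sum>p\<in>C. n + 1)"
    by (intro sum_mono) (auto intro: order_trans[OF card_image_le])
  also have "\<dots> \<le> card E * (n + 1)"
    using card_C by (simp del: mult_Suc_right)
  finally show ?thesis
    unfolding subdiv_vertices_def using card_Un_le[of V] by (meson add_left_mono order_trans)
qed

lemma card_V'_ge:
  assumes ab: "(a, b) \<in> C"
  shows "n \<le> card V'"
proof -
  have "inj_on (chain_pt n a b) {..n}"
    using n_pos C_D(6)[OF ab] by (intro inj_onI) simp
  then have "n + 1 = card (chain_pt n a b ` {..n})"
    by (simp add: card_image)
  also have "\<dots> \<le> card V'"
    using ab by (intro card_mono finite_V) (auto simp: subdiv_vertices_def)
  finally show ?thesis by simp
qed

end

text \<open>The edges are listed in an arbitrary orientation, so the drift is demanded for whichever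
  direction enters \<open>S\<close>. The given cut edge supplies a chain and thereby at least
  \<open>k\<close> vertices.\<close>

lemma has_slow_instance_if_trap:
  assumes f: "memoryless_routing f" and k: "k > 0" and cs: "convex_subdivision V E"
    and E: "E = (\<lambda>(a, b). {a, b}) ` set es" and card: "card V \<le> 7" "length es \<le> 12"
    and V: "V \<subseteq> \<Union>E" and t: "t \<in> V" "t \<notin> S" and S: "S \<subseteq> V"
    and drift: "\<forall>(a, b)\<in>set es.
      (a \<notin> S \<longrightarrow> b \<in> S \<longrightarrow> drift f t k a b) \<and> (b \<notin> S \<longrightarrow> a \<in> S \<longrightarrow> drift f t k b a)"
    and cut: "{a, b} \<in> E" "a \<notin> S" "b \<in> S"
  shows "has_slow_instance f k"
proof -
  interpret trap f V S E t k
  proof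
    fix a b assume ab: "{a, b} \<in> E" "a \<notin> S" "b \<in> S"
    then obtain c d where "(c, d) \<in> set es" "{a, b} = {c, d}"
      unfolding E by auto
    then show "drift f t k a b"
      using bspec[OF drift, of "(c, d)"] ab by (auto simp: doubleton_eq_iff)
  qed (use assms in auto)
  have "card E \<le> 12"
    unfolding E using card(2) card_image_le[of "set es"] card_length[of es] by (meson List.finite_set order_trans)
  then have "card E * (k + 1) \<le> 12 * (k + 1)"
    by (rule mult_le_mono1)
  with card_V'_le card(1) have "card V' \<le> 7 + 12 * (k + 1)"
    by (meson add_mono order_trans)
  moreover have "7 + 12 * (k + 1) \<le> 31 * k"
    using k by simp
  ultimately have "card V' \<le> 31 * k"
    by (rule order_trans)
  moreover have "k \<le> card V'"
    using cut by (intro card_V'_ge[of a b]) (simp add: C_def)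
  ultimately show ?thesis
    unfolding has_slow_instance_def using subdivision' expected_steps_trap[OF cut(3)] V_subset S cut(3) t by blast
qed

section \<open>Finding a trap\<close>

lemma open_segment_mid: "a \<noteq> b \<Longrightarrow> x + x = a + b \<Longrightarrow> x \<in> open_segment a (b :: point)"
proof -
  assume "a \<noteq> b" "x + x = a + b"
  then have "2 *\<^sub>R x = a + b" by (simp add: scaleR_2)
  then have "(1 / 2) *\<^sub>R (2 *\<^sub>R x) = (1 / 2) *\<^sub>R (a + b)" by simp
  then have "x = midpoint a b" by (simp add: midpoint_def)
  then show ?thesis using \<open>a \<noteq> b\<close> by simp
qed

lemma noncollinear_notin_segment:
  assumes "\<not> collinear {a, b, c :: point}"
  shows "a \<notin> closed_segment b c"
  using assms by (simp add: collinear_between_cases between_mem_segment)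

text \<open>If the packet drifted from \<open>c\<close> to \<open>b\<close> instead, both edges at
  \<open>b\<close> would lead into it, and \<open>{b}\<close> would be a trap in the triangle
  \<open>a\<close>, \<open>c\<close>, \<open>t\<close> with the extra vertex
  \<open>b\<close>.\<close>

lemma drift_push:
  assumes f: "memoryless_routing f" and k: "k > 0" and nc: "\<not> collinear {t, a, c}"
    and b: "b \<in> open_segment a c" and ab: "drift f t k a b"
  shows "has_slow_instance f k \<or> drift f t k b c"
proof -
  have "t \<notin> closed_segment a c"
    using nc by (rule noncollinear_notin_segment)
  moreover have "open_segment b c \<subseteq> closed_segment a c"
    using b subset_closed_segment[of b c a c] by (auto simp: open_segment_def)
  moreover have ne: "a \<noteq> b" "b \<noteq> c" "b \<noteq> t" "a \<noteq> c" "t \<noteq> a" "t \<noteq> c"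
    using b \<open>t \<notin> closed_segment a c\<close> by (auto simp: open_segment_def)
  ultimately have "drift f t k b c \<or> drift f t k c b"
    by (intro drift_either_way f k) auto
  moreover have "has_slow_instance f k" if "drift f t k c b"
  proof -
    let ?es = "[(a, b), (b, c), (c, t), (t, a)]"
    have "convex_subdivision {a, c, t} {{a, c}, {c, t}, {t, a}}"
      using nc by (intro convex_subdivision_triangle) (simp add: insert_commute)
    from convex_subdivision_insert_vertex[OF this _ b]
    have "convex_subdivision {b, a, c, t} (insert {a, b} (insert {b, c} ({{a, c}, {c, t}, {t, a}} - {{a, c}})))"
      by simp
    moreover have "insert {a, b} (insert {b, c} ({{a, c}, {c, t}, {t, a}} - {{a, c}})) = (\<lambda>(a, b). {a, b}) ` set ?es"
      using ne by (simp add: insert_Diff_if doubleton_eq_iff)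
    ultimately have cs: "convex_subdivision {b, a, c, t} ((\<lambda>(a, b). {a, b}) ` set ?es)"
      by simp
    show ?thesis
    proof (rule has_slow_instance_if_trap[where t = t and S = "{b}", OF f k cs refl])
      show "card {b, a, c, t} \<le> 7"
        using card_length[of "[b, a, c, t]"] by simp
      show "{a, b} \<in> (\<lambda>(a, b). {a, b}) ` set ?es" "a \<notin> {b}" "b \<in> {b}"
        using ne by simp_all
    qed (use ne ab that in simp_all)
  qed
  ultimately show ?thesis by blast
qed

text \<open>The trap is \<open>{z}\<close>: both edges at this corner lead into it, while
  \<open>t\<close> sits on the opposite side.\<close>

lemma drift_meet:
  assumes f: "memoryless_routing f" and k: "k > 0" and nc: "\<not> collinear {u, z, w}"
    and q: "q \<in> open_segment u z" and p: "p \<in> open_segment z w" and t: "t \<in> open_segment w u"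
    and qz: "drift f t k q z" and pz: "drift f t k p z"
  shows "has_slow_instance f k"
proof -
  let ?g = "\<lambda>(a :: point, b). {a, b}"
  have 0: "convex_subdivision {u, z, w} {{u, z}, {z, w}, {w, u}}"
    using nc by (rule convex_subdivision_triangle)
  have ne0: "u \<noteq> z" "z \<noteq> w" "w \<noteq> u"
    using nc unfolding collinear_3_eq_affine_dependent by blast+
  have "q \<notin> {u, z, w}" "p \<notin> {u, z, w}" "t \<notin> {u, z, w}"
    using convex_subdivision_vertex_on_edge[OF 0, of _ u z] convex_subdivision_vertex_on_edge[OF 0, of _ z w]
      convex_subdivision_vertex_on_edge[OF 0, of _ w u] q p t by (auto simp: open_segment_def)
  moreover have "closed_segment u z \<inter> closed_segment z w = {z}" "closed_segment z w \<inter> closed_segment w u = {w}"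
    "closed_segment w u \<inter> closed_segment u z = {u}"
    using nc by (intro Int_closed_segment disjI2; simp add: insert_commute)+
  then have "q \<noteq> p" "p \<noteq> t" "t \<noteq> q"
    using q p t by (auto simp: open_segment_def)
  ultimately have ne: "q \<noteq> u" "q \<noteq> z" "q \<noteq> w" "p \<noteq> u" "p \<noteq> z" "p \<noteq> w" "t \<noteq> u" "t \<noteq> z" "t \<noteq> w"
    "q \<noteq> p" "p \<noteq> t" "t \<noteq> q"
    by auto
  have 1: "convex_subdivision {q, u, z, w} {{u, q}, {q, z}, {z, w}, {w, u}}"
  proof -
    have *: "insert {u, q} (insert {q, z} ({{u, z}, {z, w}, {w, u}} - {{u, z}})) = {{u, q}, {q, z}, {z, w}, {w, u}}"
      using ne0 by (simp add: insert_Diff_if doubleton_eq_iff)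
    show ?thesis
      using convex_subdivision_insert_vertex[OF 0 _ q] unfolding * by simp
  qed
  have 2: "convex_subdivision {p, q, u, z, w} {{z, p}, {p, w}, {u, q}, {q, z}, {w, u}}"
  proof -
    have *: "insert {z, p} (insert {p, w} ({{u, q}, {q, z}, {z, w}, {w, u}} - {{z, w}})) = {{z, p}, {p, w}, {u, q}, {q, z}, {w, u}}"
      using ne0 ne by (simp add: insert_Diff_if doubleton_eq_iff insert_commute)
    show ?thesis
      using convex_subdivision_insert_vertex[OF 1 _ p] unfolding * by simp
  qed
  let ?es = "[(w, t), (t, u), (z, p), (p, w), (u, q), (q, z)]"
  have 3: "convex_subdivision {t, p, q, u, z, w} (?g ` set ?es)"
  proof -
    have *: "insert {w, t} (insert {t, u} ({{z, p}, {p, w}, {u, q}, {q, z}, {w, u}} - {{w, u}})) = ?g ` set ?es"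
      using ne0 ne by (simp add: insert_Diff_if doubleton_eq_iff insert_commute)
    show ?thesis
      using convex_subdivision_insert_vertex[OF 2 _ t] unfolding * by simp
  qed
  show ?thesis
  proof (rule has_slow_instance_if_trap[where t = t and S = "{z}", OF f k 3 refl])
    show "card {t, p, q, u, z, w} \<le> 7"
      using card_length[of "[t, p, q, u, z, w]"] by simp
    show "{q, z} \<in> ?g ` set ?es" "q \<notin> {z}" "z \<in> {z}"
      using ne by simp_all
  qed (use ne ne0 qz pz in simp_all)
qed

section \<open>Coordinates and numerical tests for incidence\<close>

definition double_area :: "real \<times> real \<Rightarrow> real \<times> real \<Rightarrow> real \<times> real \<Rightarrow> real" where
  "double_area a b c = (fst b - fst a) * (snd c - snd a) - (snd b - snd a) * (fst c - fst a)"

text \<open>An arbitrary basis yields mirror images for free: exchanging \<open>e\<close> and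
  \<open>h\<close> exchanges counterclockwise and clockwise. Coordinates are pairs of reals, so that
  concrete configurations can be checked by evaluation.\<close>

locale frame =
  fixes e h :: point
  assumes inj: "x *\<^sub>R e + y *\<^sub>R h = x' *\<^sub>R e + y' *\<^sub>R h \<Longrightarrow> x = x' \<and> y = y'"
    and surj: "\<exists>x y. p = x *\<^sub>R e + y *\<^sub>R h"
begin

definition Pt :: "real \<times> real \<Rightarrow> point" where
  "Pt a = fst a *\<^sub>R e + snd a *\<^sub>R h"

lemma Pt_eq_iff [simp]: "Pt a = Pt b \<longleftrightarrow> a = b"
  using inj by (auto simp: Pt_def prod_eq_iff)

lemma Pt_surj: obtains a where "p = Pt a"
  using surj[of p] by (auto simp: Pt_def)

lemma Pt_add: "Pt a + Pt b = Pt (a + b)"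
  by (simp add: Pt_def algebra_simps)

lemma Pt_scale: "r *\<^sub>R Pt a = Pt (r *\<^sub>R a)"
  by (simp add: Pt_def algebra_simps)

lemma noncollinear_Pt:
  assumes "double_area a b c \<noteq> 0"
  shows "\<not> collinear {Pt a, Pt b, Pt c}"
proof
  have diff: "Pt x - Pt y = Pt (x - y)" for x y
    by (simp add: Pt_def algebra_simps)
  have zero: "Pt x = 0 \<longleftrightarrow> x = 0" for x
    using Pt_eq_iff[of x 0] by (simp add: Pt_def)
  assume "collinear {Pt a, Pt b, Pt c}"
  then have "a - b = 0 \<or> c - b = 0 \<or> (\<exists>r. c - b = r *\<^sub>R (a - b))"
    by (simp add: collinear_3[of "Pt a"] collinear_lemma diff zero Pt_scale)
  then consider "a = b" | "c = b" | r where "c = b + r *\<^sub>R (a - b)"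
    by (auto simp: algebra_simps)
  then have "double_area a b c = 0"
  proof cases
    case (3 r)
    show ?thesis unfolding 3 by (simp add: double_area_def algebra_simps)
  qed (simp_all add: double_area_def)
  then show False
    using assms by simp
qed

lemma in_closed_segment_Pt:
  "Pt p \<in> closed_segment (Pt a) (Pt b) \<longleftrightarrow> (\<exists>u. 0 \<le> u \<and> u \<le> 1 \<and> p = (1 - u) *\<^sub>R a + u *\<^sub>R b)"
  by (simp add: in_segment Pt_scale Pt_add)

text \<open>The signed area is affine in its third argument.\<close>

lemma double_area_segment:
  assumes "Pt p \<in> closed_segment (Pt a) (Pt b)"
  shows "\<exists>u. 0 \<le> u \<and> u \<le> 1 \<and> double_area c d p = (1 - u) * double_area c d a + u * double_area c d b"
proof -
  obtain u where u: "0 \<le> u" "u \<le> 1" and p: "p = (1 - u) *\<^sub>R a + u *\<^sub>R b"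
    using assms by (auto simp: in_closed_segment_Pt)
  have "double_area c d p = (1 - u) * double_area c d a + u * double_area c d b"
    unfolding p by (simp add: double_area_def algebra_simps)
  then show ?thesis
    using u by blast
qed

lemma double_area_segment_self: "Pt p \<in> closed_segment (Pt a) (Pt b) \<Longrightarrow> double_area a b p = 0"
  using double_area_segment[of p a b a b] by (auto simp: double_area_def)

text \<open>The points \<open>c\<close> and \<open>d\<close> lie strictly on one side of the line
  through \<open>a\<close> and \<open>b\<close>.\<close>

lemma segments_apart:
  assumes "double_area a b c * double_area a b d > 0"
  shows "closed_segment (Pt a) (Pt b) \<inter> closed_segment (Pt c) (Pt d) = {}"
proof (intro equals0I)
  fix x assume x: "x \<in> closed_segment (Pt a) (Pt b) \<inter> closed_segment (Pt c) (Pt d)"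
  obtain p where p: "x = Pt p" by (rule Pt_surj)
  obtain u where u: "0 \<le> u" "u \<le> 1" "(1 - u) * double_area a b c + u * double_area a b d = 0"
    using x double_area_segment[of p c d a b] double_area_segment_self[of p a b] unfolding p by auto
  have "double_area a b c * ((1 - u) * double_area a b c + u * double_area a b d) =
      (1 - u) * (double_area a b c)\<^sup>2 + u * (double_area a b c * double_area a b d)"
    by (simp add: algebra_simps power2_eq_square)
  moreover have "0 < (1 - u) * (double_area a b c)\<^sup>2 + u * (double_area a b c * double_area a b d)"
  proof (cases "u = 0")
    case True
    then show ?thesis using assms by auto
  next
    case False
    then show ?thesis
      using u by (intro add_nonneg_pos mult_nonneg_nonneg mult_pos_pos[OF _ assms]) auto
  qed
  ultimately show False
    using u(3) by simp
qed

text \<open>A sufficient numerical test; the last disjunct covers consecutive collinear edges of equal length.\<close>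
definition meet_at_ends :: "real \<times> real \<Rightarrow> real \<times> real \<Rightarrow> real \<times> real \<Rightarrow> real \<times> real \<Rightarrow> bool" where
  "meet_at_ends a b c d \<longleftrightarrow> double_area a b c * double_area a b d > 0 \<or> double_area c d a * double_area c d b > 0 \<or>
     (c = a \<or> c = b) \<and> double_area a b d \<noteq> 0 \<or> (d = a \<or> d = b) \<and> double_area a b c \<noteq> 0 \<or>
     b = c \<and> b + b = a + d"

lemma segments_share:
  assumes "double_area a b d \<noteq> 0"
  shows "closed_segment (Pt a) (Pt b) \<inter> closed_segment (Pt b) (Pt d) = {Pt b}"
  using noncollinear_Pt[OF assms] by (intro Int_closed_segment) blast

lemma meet_at_ends:
  assumes "meet_at_ends a b c d"
  shows "closed_segment (Pt a) (Pt b) \<inter> closed_segment (Pt c) (Pt d) \<subseteq> {Pt a, Pt b} \<inter> {Pt c, Pt d}"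
proof -
  have double_area_swap: "double_area b a x = 0 \<longleftrightarrow> double_area a b x = 0" for x
    by (auto simp: double_area_def algebra_simps)
  have commute: "closed_segment (Pt x) (Pt y) = closed_segment (Pt y) (Pt x)" for x y
    by (rule closed_segment_commute)
  consider "double_area a b c * double_area a b d > 0" | "double_area c d a * double_area c d b > 0"
    | "c = a" "double_area a b d \<noteq> 0" | "c = b" "double_area a b d \<noteq> 0"
    | "d = a" "double_area a b c \<noteq> 0" | "d = b" "double_area a b c \<noteq> 0" | "b = c" "b + b = a + d"
    using assms unfolding meet_at_ends_def by blast
  then show ?thesis
  proof cases
    case 1
    then show ?thesis using segments_apart[of a b c d] by simp
  next
    case 2
    then show ?thesis using segments_apart[of c d a b] by (simp add: Int_commute)
  next
    case 3
    have "closed_segment (Pt a) (Pt b) \<inter> closed_segment (Pt a) (Pt d) = {Pt a}"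
      using segments_share[of b a d] 3 double_area_swap unfolding commute[of b a] by blast
    then show ?thesis using 3 by simp
  next
    case 4
    then show ?thesis using segments_share[of a b d] by simp
  next
    case 5
    have "closed_segment (Pt a) (Pt b) \<inter> closed_segment (Pt c) (Pt a) = {Pt a}"
      using segments_share[of b a c] 5 double_area_swap unfolding commute[of b a] commute[of c a] by blast
    then show ?thesis using 5 by simp
  next
    case 6
    have "closed_segment (Pt a) (Pt b) \<inter> closed_segment (Pt c) (Pt b) = {Pt b}"
      using segments_share[of a b c] 6 unfolding commute[of c b] by blast
    then show ?thesis using 6 by simp
  next
    case 7
    have "Pt b \<in> closed_segment (Pt a) (Pt d)"
    proof (cases "a = d")
      case True
      then have "a = b" using 7 by (auto simp: prod_eq_iff)
      then show ?thesis by simp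
    next
      case False
      then have "Pt b \<in> open_segment (Pt a) (Pt d)"
        using 7 by (intro open_segment_mid) (simp_all add: Pt_add)
      then show ?thesis by (simp add: open_segment_def)
    qed
    then have "closed_segment (Pt a) (Pt b) \<inter> closed_segment (Pt b) (Pt d) = {Pt b}"
      by (intro Int_closed_segment) blast
    then show ?thesis using 7 by simp
  qed
qed

text \<open>A positive product means that \<open>p\<close> lies outside the range of the segment in
  that coordinate.\<close>

definition off_segment :: "real \<times> real \<Rightarrow> real \<times> real \<Rightarrow> real \<times> real \<Rightarrow> bool" where
  "off_segment a b p \<longleftrightarrow> double_area a b p \<noteq> 0 \<or> (fst p - fst a) * (fst p - fst b) > 0 \<or> (snd p - snd a) * (snd p - snd b) > 0"

lemma off_segment:
  assumes "off_segment a b p"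
  shows "Pt p \<notin> closed_segment (Pt a) (Pt b)"
proof
  assume p: "Pt p \<in> closed_segment (Pt a) (Pt b)"
  then obtain u where u: "0 \<le> u" "u \<le> 1" "p = (1 - u) *\<^sub>R a + u *\<^sub>R b"
    by (auto simp: in_closed_segment_Pt)
  have "((1 - u) * x + u * y - x) * ((1 - u) * x + u * y - y) = - (u * (1 - u) * (x - y)\<^sup>2)" for x y :: real
    by (simp add: algebra_simps power2_eq_square)
  moreover have "0 \<le> u * (1 - u) * (x - y)\<^sup>2" for x y
    using u by simp
  ultimately have "(fst p - fst a) * (fst p - fst b) \<le> 0" "(snd p - snd a) * (snd p - snd b) \<le> 0"
    by (simp_all add: u(3))
  then show False
    using assms double_area_segment_self[OF p] by (simp add: off_segment_def)
qed

text \<open>Barycentric coordinates are ratios of signed areas. The predicate \<open>P\<close>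
  serves the closed triangle and its interior at once.\<close>

lemma triangle_bary:
  assumes pos: "double_area a b c > 0"
  shows "(\<exists>u v w. P u \<and> P v \<and> P w \<and> u + v + w = 1 \<and> u *\<^sub>R a + v *\<^sub>R b + w *\<^sub>R c = p) \<longleftrightarrow>
    P (double_area b c p / double_area a b c) \<and> P (double_area c a p / double_area a b c) \<and> P (double_area a b p / double_area a b c)"
    (is "?L \<longleftrightarrow> ?R")
proof
  assume ?L
  then obtain u v w where *: "P u" "P v" "P w" "u + v + w = 1" "p = u *\<^sub>R a + v *\<^sub>R b + w *\<^sub>R c"
    by blast
  have u: "u = 1 - v - w" using * by simp
  have "double_area b c p = u * double_area a b c" "double_area c a p = v * double_area a b c" "double_area a b p = w * double_area a b c"
    unfolding *(5) u by (simp_all add: double_area_def algebra_simps)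
  then show ?R
    using * pos by simp
next
  assume ?R
  let ?D = "double_area a b c"
  have "double_area b c p + double_area c a p + double_area a b p = ?D"
    by (simp add: double_area_def algebra_simps)
  then have "double_area b c p / ?D + double_area c a p / ?D + double_area a b p / ?D = 1"
    using pos by (simp flip: add_divide_distrib)
  moreover have "double_area b c p * fst a + double_area c a p * fst b + double_area a b p * fst c = ?D * fst p"
    "double_area b c p * snd a + double_area c a p * snd b + double_area a b p * snd c = ?D * snd p"
    by (simp_all add: double_area_def algebra_simps)
  then have "(double_area b c p / ?D) *\<^sub>R a + (double_area c a p / ?D) *\<^sub>R b + (double_area a b p / ?D) *\<^sub>R c = p"
    using pos by (simp add: prod_eq_iff flip: add_divide_distrib)
  ultimately show ?L
    using \<open>?R\<close> by blast
qed

lemma in_triangle_Pt: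
  assumes "double_area a b c > 0"
  shows "Pt p \<in> convex hull {Pt a, Pt b, Pt c} \<longleftrightarrow> 0 \<le> double_area b c p \<and> 0 \<le> double_area c a p \<and> 0 \<le> double_area a b p"
  using triangle_bary[OF assms, of "\<lambda>u. 0 \<le> u" p] assms
  by (simp add: convex_hull_3 Pt_scale Pt_add zero_le_divide_iff) (metis)

lemma in_interior_triangle_Pt:
  assumes "double_area a b c > 0"
  shows "Pt p \<in> interior (convex hull {Pt a, Pt b, Pt c}) \<longleftrightarrow> 0 < double_area b c p \<and> 0 < double_area c a p \<and> 0 < double_area a b p"
  using triangle_bary[OF assms, of "\<lambda>u. 0 < u" p] assms noncollinear_Pt[of a b c]
  by (simp add: interior_convex_hull_3_minimal Pt_scale Pt_add zero_less_divide_iff)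

lemma plane_geometric_graph_Pt:
  assumes "finite V" "\<forall>(a, b)\<in>set es. a \<in> V \<and> b \<in> V \<and> a \<noteq> b"
    and cross: "sorted_wrt (\<lambda>(a, b) (c, d). meet_at_ends a b c d) es"
    and vert: "\<forall>p\<in>V. \<forall>(a, b)\<in>set es. p = a \<or> p = b \<or> off_segment a b p"
  shows "plane_geometric_graph (Pt ` V) ((\<lambda>(a, b). {a, b}) ` set (map (map_prod Pt Pt) es))"
proof (rule plane_geometric_graphI[OF _ _ _ _ refl])
  show "sorted_wrt (\<lambda>(a, b) (c, d). closed_segment a b \<inter> closed_segment c d \<subseteq> {a, b} \<inter> {c, d}) (map (map_prod Pt Pt) es)"
    unfolding sorted_wrt_map by (rule sorted_wrt_mono_rel[OF _ cross]) (unfold case_prod_unfold fst_map_prod snd_map_prod, rule meet_at_ends)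
  show "v \<in> {a, b}" if "v \<in> Pt ` V" "(a, b) \<in> set (map (map_prod Pt Pt) es)" "v \<in> closed_segment a b" for v a b
    using that vert off_segment by fastforce
qed (use assms(1,2) in auto)

section \<open>The pinwheel\<close>

text \<open>The inner triangle (0, 0), (3, 0), (0, 3) has centroid (1, 1). Each side is extended
  beyond one corner by its own length, so that every inner corner is the midpoint of two collinear
  edges.\<close>

lemma convex_subdivision_pinwheel:
  fixes vs :: "(real \<times> real) list" and es :: "((real \<times> real) \<times> (real \<times> real)) list"
  defines "vs \<equiv> [(0, 0), (3, 0), (0, 3), (1, 1), (6, 0), (-3, 6), (0, -3)]"
    and "es \<equiv> [((0, -3), (6, 0)), ((6, 0), (-3, 6)), ((-3, 6), (0, -3)),
      ((0, 0), (3, 0)), ((3, 0), (0, 3)), ((0, 3), (0, 0)),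
      ((0, 0), (0, -3)), ((3, 0), (6, 0)), ((0, 3), (-3, 6)),
      ((1, 1), (0, 0)), ((1, 1), (3, 0)), ((1, 1), (0, 3))]"
  shows "convex_subdivision (Pt ` set vs) ((\<lambda>(a, b). {a, b}) ` set (map (map_prod Pt Pt) es))"
    (is "convex_subdivision ?V ?E")
proof (rule convex_subdivision_tiling)
  \<comment> \<open>Three tiles surround the centroid. Each of the three outer tiles is a triangle
    with an inner corner in the middle of one side, where the face has a straight angle.\<close>
  define ts :: "((real \<times> real) \<times> (real \<times> real) \<times> (real \<times> real)) list" where
    "ts = [((1, 1), (0, 0), (3, 0)), ((1, 1), (3, 0), (0, 3)), ((1, 1), (0, 3), (0, 0)),
      ((0, -3), (6, 0), (0, 0)), ((6, 0), (-3, 6), (3, 0)), ((-3, 6), (0, -3), (0, 3))]"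
  define tri where "tri = (\<lambda>(a, b, c). convex hull {Pt a, Pt b, Pt c})"
  have pos: "\<forall>(a, b, c)\<in>set ts. double_area a b c > 0"
    by (simp add: ts_def double_area_def)
  have outer_pos: "double_area (0, -3) (6, 0) (-3, 6) > 0"
    by (simp add: double_area_def)
  have union: "\<Union>(tri ` set ts) = convex hull {Pt (0, -3), Pt (6, 0), Pt (-3, 6)}"
  proof (rule set_eqI)
    fix p
    obtain x y where p: "p = Pt (x, y)" using Pt_surj[of p] by (metis surj_pair)
    have "p \<in> \<Union>(tri ` set ts) \<longleftrightarrow> (\<exists>(a, b, c)\<in>set ts. 0 \<le> double_area b c (x, y) \<and> 0 \<le> double_area c a (x, y) \<and> 0 \<le> double_area a b (x, y))"
      using pos in_triangle_Pt unfolding p tri_def by fastforce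
    \<comment> \<open>That the six tiles cover exactly the outer triangle is a Boolean statement
      about linear inequalities in \<open>x\<close> and \<open>y\<close>.\<close>
    also have "\<dots> \<longleftrightarrow> 0 \<le> double_area (6, 0) (-3, 6) (x, y) \<and> 0 \<le> double_area (-3, 6) (0, -3) (x, y) \<and> 0 \<le> double_area (0, -3) (6, 0) (x, y)"
      unfolding ts_def double_area_def by simp argo
    also have "\<dots> \<longleftrightarrow> p \<in> convex hull {Pt (0, -3), Pt (6, 0), Pt (-3, 6)}"
      unfolding p using in_triangle_Pt[OF outer_pos] by simp
    finally show "p \<in> \<Union>(tri ` set ts) \<longleftrightarrow> p \<in> convex hull {Pt (0, -3), Pt (6, 0), Pt (-3, 6)}" .
  qed
  show "convex_polygon T" if "T \<in> tri ` set ts" for T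
    using that pos unfolding tri_def by (auto intro!: convex_polygon_triangle noncollinear_Pt dest!: bspec)
  show "convex_polygon (\<Union>(tri ` set ts))"
    unfolding union using outer_pos by (intro convex_polygon_triangle noncollinear_Pt) simp
  show "plane_geometric_graph ?V ?E"
  proof (rule plane_geometric_graph_Pt)
    show "sorted_wrt (\<lambda>(a, b) (c, d). meet_at_ends a b c d) es"
      unfolding es_def by (simp add: meet_at_ends_def double_area_def)
    show "\<forall>p\<in>set vs. \<forall>(a, b)\<in>set es. p = a \<or> p = b \<or> off_segment a b p"
      unfolding es_def vs_def by (simp add: off_segment_def double_area_def)
  qed (simp_all add: es_def vs_def)
  have sep: "sorted_wrt (\<lambda>(a, b, c) (a', b', c'). \<forall>x y. \<not> (0 < double_area b c (x, y) \<and> 0 < double_area c a (x, y) \<and> 0 < double_area a b (x, y) \<and>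
      0 < double_area b' c' (x, y) \<and> 0 < double_area c' a' (x, y) \<and> 0 < double_area a' b' (x, y))) ts"
    unfolding ts_def double_area_def by (simp; intro conjI allI impI; linarith)
  have ordered: "interior (tri (ts ! i)) \<inter> interior (tri (ts ! j)) = {}" if ij: "i < j" "j < length ts" for i j
  proof (intro equals0I)
    fix p assume p: "p \<in> interior (tri (ts ! i)) \<inter> interior (tri (ts ! j))"
    obtain a b c a' b' c' where T: "ts ! i = (a, b, c)" "ts ! j = (a', b', c')"
      by (metis prod_cases3)
    obtain x y where xy: "p = Pt (x, y)" using Pt_surj[of p] by (metis surj_pair)
    have "0 < double_area a b c" "0 < double_area a' b' c'"
      using bspec[OF pos nth_mem, of i] bspec[OF pos nth_mem, of j] ij T by auto
    then show False
      using p sorted_wrt_nth_less[OF sep ij] unfolding xy T tri_def by (auto simp: in_interior_triangle_Pt)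
  qed
  show "interior S \<inter> interior T = {}" if S: "S \<in> tri ` set ts" and T: "T \<in> tri ` set ts" and "S \<noteq> T" for S T
  proof -
    obtain i where i: "S = tri (ts ! i)" "i < length ts"
      using S by (elim imageE) (metis in_set_conv_nth)
    obtain j where j: "T = tri (ts ! j)" "j < length ts"
      using T by (elim imageE) (metis in_set_conv_nth)
    have "i \<noteq> j"
      using \<open>S \<noteq> T\<close> i(1) j(1) by blast
    then consider "i < j" | "j < i"
      by linarith
    then show ?thesis
    proof cases
      case 1
      show ?thesis using ordered[OF 1 j(2)] i(1) j(1) by simp
    next
      case 2
      show ?thesis using ordered[OF 2 i(2)] i(1) j(1) by (simp add: Int_commute)
    qed
  qed
  have split: "closed_segment (Pt a) (Pt c) = closed_segment (Pt a) (Pt b) \<union> closed_segment (Pt b) (Pt c)"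
    if "a \<noteq> c" "b + b = a + c" for a b c
    using open_segment_mid[of "Pt a" "Pt c" "Pt b"] that Un_closed_segment[of "Pt b" "Pt a" "Pt c"]
    by (simp add: Pt_add open_segment_def)
  \<comment> \<open>These are the sides of the outer tiles that consist of two edges of the
    graph.\<close>
  have s1: "closed_segment (Pt (6, 0)) (Pt (0, 0)) = closed_segment (Pt (6, 0)) (Pt (3, 0)) \<union> closed_segment (Pt (3, 0)) (Pt (0, 0))"
    and s2: "closed_segment (Pt (3, 0)) (Pt (-3, 6)) = closed_segment (Pt (3, 0)) (Pt (0, 3)) \<union> closed_segment (Pt (0, 3)) (Pt (-3, 6))"
    and s3: "closed_segment (Pt (0, -3)) (Pt (0, 3)) = closed_segment (Pt (0, -3)) (Pt (0, 0)) \<union> closed_segment (Pt (0, 0)) (Pt (0, 3))"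
    by (intro split; simp)+
  have "(\<Union>T\<in>tri ` set ts. frontier T) = (\<Union>(a, b, c)\<in>set ts. closed_segment (Pt a) (Pt b) \<union> closed_segment (Pt b) (Pt c) \<union> closed_segment (Pt c) (Pt a))"
    unfolding tri_def by (simp add: frontier_of_triangle case_prod_unfold)
  also have "\<dots> = (\<Union>(a, b)\<in>set es. closed_segment (Pt a) (Pt b))"
  proof -
    define \<sigma> where "\<sigma> a b = closed_segment (Pt a) (Pt b)" for a b
    have commute: "\<sigma> a b = \<sigma> b a" for a b
      unfolding \<sigma>_def by (rule closed_segment_commute)
    note reversed = commute[of "(0, 0)" "(1, 1)"] commute[of "(3, 0)" "(1, 1)"] commute[of "(0, 3)" "(1, 1)"]
      commute[of "(6, 0)" "(3, 0)"] commute[of "(3, 0)" "(0, 0)"] commute[of "(0, -3)" "(0, 0)"]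
      commute[of "(0, 0)" "(0, 3)"] commute[of "(-3, 6)" "(3, 0)"] commute[of "(-3, 6)" "(0, 3)"]
    show ?thesis
      using s1 s2 s3 unfolding ts_def es_def \<sigma>_def[symmetric]
      by (simp only: list.set UN_insert UN_empty case_prod_conv reversed Un_empty_right) (simp only: Un_ac Un_left_absorb)
  qed
  also have "\<dots> = ?V \<union> (\<Union>e\<in>?E. seg e)"
  proof -
    have "(\<Union>e\<in>?E. seg e) = (\<Union>(a, b)\<in>set es. closed_segment (Pt a) (Pt b))"
      by (simp add: case_prod_unfold image_image)
    moreover have "\<forall>v\<in>set vs. \<exists>(a, b)\<in>set es. v = a \<or> v = b"
      unfolding vs_def es_def by simp
    then have "?V \<subseteq> (\<Union>(a, b)\<in>set es. closed_segment (Pt a) (Pt b))"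
      by fastforce
    ultimately show ?thesis by blast
  qed
  finally show "?V \<union> (\<Union>e\<in>?E. seg e) = (\<Union>T\<in>tri ` set ts. frontier T)" ..
qed

text \<open>The cut around the three outer vertices consists of the three extensions; the sides of
  the outer triangle run inside the trap.\<close>

lemma has_slow_instance_if_pinwheel:
  assumes f: "memoryless_routing f" and k: "k > 0"
    and "drift f (Pt (1, 1)) k (Pt (3, 0)) (Pt (6, 0))"
    and "drift f (Pt (1, 1)) k (Pt (0, 3)) (Pt (-3, 6))"
    and "drift f (Pt (1, 1)) k (Pt (0, 0)) (Pt (0, -3))"
  shows "has_slow_instance f k"
proof (rule has_slow_instance_if_trap[where t = "Pt (1, 1)" and S = "{Pt (6, 0), Pt (-3, 6), Pt (0, -3)}" and a = "Pt (0, 0)"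
      and b = "Pt (0, -3)", OF f k convex_subdivision_pinwheel refl])
  show "card (Pt ` set [(0, 0), (3, 0), (0, 3), (1, 1), (6, 0), (-3, 6), (0, -3)]) \<le> 7"
    by (rule order_trans[OF card_image_le]) (simp_all add: card_insert_if)
qed (use assms in simp_all)

text \<open>\<open>drift_push\<close> on a parametrised line that misses \<open>t\<close>: the drift
  propagates in its own direction.\<close>

lemma drift_along:
  assumes f: "memoryless_routing f" and k: "k > 0" and easy: "\<not> has_slow_instance f k"
    and off: "double_area t a (a + d) \<noteq> 0" and rsu: "r < s" "s < u"
    and drift: "drift f (Pt t) k (Pt (a + r *\<^sub>R d)) (Pt (a + s *\<^sub>R d))"
  shows "drift f (Pt t) k (Pt (a + s *\<^sub>R d)) (Pt (a + u *\<^sub>R d))"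
proof -
  have "double_area t (a + r *\<^sub>R d) (a + u *\<^sub>R d) = (u - r) * double_area t a (a + d)"
    by (simp add: double_area_def algebra_simps)
  then have "\<not> collinear {Pt t, Pt (a + r *\<^sub>R d), Pt (a + u *\<^sub>R d)}"
    using off rsu by (intro noncollinear_Pt) simp
  moreover have "Pt (a + s *\<^sub>R d) \<in> open_segment (Pt (a + r *\<^sub>R d)) (Pt (a + u *\<^sub>R d))"
  proof -
    \<comment> \<open>The relative position of \<open>s\<close> between \<open>r\<close> and
      \<open>u\<close>.\<close>
    define c where "c = (s - r) / (u - r)"
    have c: "0 < c" "c < 1" "s = r + c * (u - r)"
      using rsu by (simp_all add: c_def field_simps)
    have "d \<noteq> 0"
      using off by (auto simp: double_area_def)
    moreover have "a + s *\<^sub>R d = (1 - c) *\<^sub>R (a + r *\<^sub>R d) + c *\<^sub>R (a + u *\<^sub>R d)"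
      unfolding c(3) by (simp add: algebra_simps)
    ultimately show ?thesis
      unfolding in_segment Pt_scale Pt_add Pt_eq_iff using c rsu by auto
  qed
  ultimately show ?thesis
    using drift_push[OF f k _ _ drift] easy by blast
qed

lemma has_slow_instance_if_meet:
  assumes "memoryless_routing f" "k > 0" and nc: "double_area u z w \<noteq> 0"
    and mid: "q + q = u + z" "p + p = z + w" "t + t = w + u"
    and "drift f (Pt t) k (Pt q) (Pt z)" "drift f (Pt t) k (Pt p) (Pt z)"
  shows "has_slow_instance f k"
proof (rule drift_meet[OF assms(1,2) noncollinear_Pt[OF nc] _ _ _ assms(7,8)])
  have "u \<noteq> z" "z \<noteq> w" "w \<noteq> u"
    using nc by (auto simp: double_area_def)
  then show "Pt q \<in> open_segment (Pt u) (Pt z)" "Pt p \<in> open_segment (Pt z) (Pt w)"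
    "Pt t \<in> open_segment (Pt w) (Pt u)"
    using mid by (auto intro!: open_segment_mid simp: Pt_add)
qed

text \<open>Each side is parametrised from 0 to 3, counterclockwise in the coordinates of the frame.
  Drift on the middle third forces drift on the last third and then on the extension from 3 to
  6.\<close>

lemma drift_around:
  assumes f: "memoryless_routing f" and k: "k > 0" and easy: "\<not> has_slow_instance f k"
  shows "drift f (Pt (1, 1)) k (Pt (1, 0)) (Pt (2, 0)) \<Longrightarrow>
      drift f (Pt (1, 1)) k (Pt (2, 0)) (Pt (3, 0)) \<and> drift f (Pt (1, 1)) k (Pt (3, 0)) (Pt (6, 0))"
    and "drift f (Pt (1, 1)) k (Pt (2, 1)) (Pt (1, 2)) \<Longrightarrow>
      drift f (Pt (1, 1)) k (Pt (1, 2)) (Pt (0, 3)) \<and> drift f (Pt (1, 1)) k (Pt (0, 3)) (Pt (-3, 6))"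
    and "drift f (Pt (1, 1)) k (Pt (0, 2)) (Pt (0, 1)) \<Longrightarrow>
      drift f (Pt (1, 1)) k (Pt (0, 1)) (Pt (0, 0)) \<and> drift f (Pt (1, 1)) k (Pt (0, 0)) (Pt (0, -3))"
  using drift_along[OF f k easy, of "(1, 1)" "(0, 0)" "(1, 0)" 1 2 3]
    drift_along[OF f k easy, of "(1, 1)" "(0, 0)" "(1, 0)" 2 3 6]
    drift_along[OF f k easy, of "(1, 1)" "(3, 0)" "(-1, 1)" 1 2 3]
    drift_along[OF f k easy, of "(1, 1)" "(3, 0)" "(-1, 1)" 2 3 6]
    drift_along[OF f k easy, of "(1, 1)" "(0, 3)" "(0, -1)" 1 2 3]
    drift_along[OF f k easy, of "(1, 1)" "(0, 3)" "(0, -1)" 2 3 6]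
  by (simp_all add: double_area_def)

end

lemma has_slow_instance_in_frame:
  assumes "frame e h" and f: "memoryless_routing f" and k: "k > 0"
  shows "has_slow_instance f k"
proof (rule ccontr)
  assume easy: "\<not> has_slow_instance f k"
  interpret frame e h by fact
  interpret swap: frame h e
  proof
    show "y = y' \<and> x = x'" if "y *\<^sub>R h + x *\<^sub>R e = y' *\<^sub>R h + x' *\<^sub>R e" for x y x' y'
      using inj[of x y x' y'] that by (simp add: add.commute)
    show "\<exists>y x. p = y *\<^sub>R h + x *\<^sub>R e" for p
      using surj[of p] by (metis add.commute)
  qed
  have swap: "swap.Pt (x, y) = Pt (y, x)" for x y
    by (simp add: Pt_def swap.Pt_def)
  let ?D = "\<lambda>a b. drift f (Pt (1, 1)) k (Pt a) (Pt b)"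
  note ccw = drift_around[OF f k easy]
  \<comment> \<open>The mirrored frame provides the clockwise versions, with the coordinates of
    every point exchanged.\<close>
  note cw = swap.drift_around[OF f k easy, unfolded swap]
  have either: "?D a b \<or> ?D b a" if "double_area (1, 1) a b \<noteq> 0" for a b
  proof (rule drift_either_way[OF f k])
    show "Pt a \<noteq> Pt b"
      using that by (auto simp: double_area_def)
    show "Pt (1, 1) \<notin> open_segment (Pt a) (Pt b)"
      using noncollinear_notin_segment[OF noncollinear_Pt[OF that]] by (simp add: open_segment_def)
  qed
  have sides: "?D (1, 0) (2, 0) \<or> ?D (2, 0) (1, 0)" "?D (2, 1) (1, 2) \<or> ?D (1, 2) (2, 1)"
    "?D (0, 2) (0, 1) \<or> ?D (0, 1) (0, 2)"
    by (rule either; simp add: double_area_def)+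
  \<comment> \<open>At each corner the auxiliary triangle is chosen so that (1, 1) is the midpoint
    of its opposite side. Going round, a counterclockwise side is thus never followed by a clockwise
    one, and on a cycle this makes all three sides agree.\<close>
  have "\<not> (?D (2, 0) (3, 0) \<and> ?D (2, 1) (3, 0))"
    using has_slow_instance_if_meet[OF f k, of "(1, 0)" "(3, 0)" "(1, 2)" "(2, 0)" "(2, 1)" "(1, 1)"] easy
    by (auto simp: double_area_def)
  moreover have "\<not> (?D (1, 2) (0, 3) \<and> ?D (0, 2) (0, 3))"
    using has_slow_instance_if_meet[OF f k, of "(2, 1)" "(0, 3)" "(0, 1)" "(1, 2)" "(0, 2)" "(1, 1)"] easy
    by (auto simp: double_area_def)
  moreover have "\<not> (?D (0, 1) (0, 0) \<and> ?D (1, 0) (0, 0))"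
    using has_slow_instance_if_meet[OF f k, of "(0, 2)" "(0, 0)" "(2, 0)" "(0, 1)" "(1, 0)" "(1, 1)"] easy
    by (auto simp: double_area_def)
  ultimately consider "?D (1, 0) (2, 0)" "?D (2, 1) (1, 2)" "?D (0, 2) (0, 1)"
    | "?D (2, 0) (1, 0)" "?D (1, 2) (2, 1)" "?D (0, 1) (0, 2)"
    using sides ccw cw by blast
  then show False
  proof cases
    case 1
    then show ?thesis
      using has_slow_instance_if_pinwheel[OF f k] ccw easy by blast
  next
    case 2
    then show ?thesis
      using swap.has_slow_instance_if_pinwheel[OF f k, unfolded swap] cw easy by blast
  qed
qed

lemma frame_axis: "frame (axis 1 1) (axis 2 1)"
proof
  show "x = x' \<and> y = y'" if "x *\<^sub>R axis 1 1 + y *\<^sub>R axis 2 1 = x' *\<^sub>R axis 1 1 + y' *\<^sub>R (axis 2 1 :: point)" for x y x' y'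
    using that by (simp add: vec_eq_iff forall_2 axis_def)
  show "\<exists>x y. p = x *\<^sub>R axis 1 1 + y *\<^sub>R axis 2 1" for p :: point
    by (intro exI[of _ "p $ 1"] exI[of _ "p $ 2"]) (simp add: vec_eq_iff forall_2 axis_def)
qed

theorem theorem2:
  shows "\<exists>c1 c2 c3 :: real. c1 > 0 \<and> c2 > 0 \<and> c3 > 0 \<and>
    (\<forall>k :: nat. k > 0 \<longrightarrow>
      (\<forall>f. memoryless_routing f \<longrightarrow>
        (\<exists>V E s t. convex_subdivision V E \<and> s \<in> V \<and> t \<in> V \<and>
           c1 * real k \<le> real (card V) \<and> real (card V) \<le> c2 * real k \<and>
           expected_steps f E s t \<ge> ennreal (c3 * (real k)\<^sup>2))))"
proof (rule exI[of _ 1], rule exI[of _ 31], rule exI[of _ 1], intro conjI allI impI)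
  fix k :: nat and f
  assume "k > 0" "memoryless_routing f"
  then obtain V E s t where "convex_subdivision V E" "s \<in> V" "t \<in> V" "k \<le> card V" "card V \<le> 31 * k"
    "ennreal ((real k)\<^sup>2) \<le> expected_steps f E s t"
    using has_slow_instance_in_frame[OF frame_axis] unfolding has_slow_instance_def by blast
  moreover from \<open>card V \<le> 31 * k\<close> have "real (card V) \<le> 31 * real k"
    by linarith
  ultimately show "\<exists>V E s t. convex_subdivision V E \<and> s \<in> V \<and> t \<in> V \<and>
      1 * real k \<le> real (card V) \<and> real (card V) \<le> 31 * real k \<and>
      expected_steps f E s t \<ge> ennreal (1 * (real k)\<^sup>2)"
    by (intro exI[of _ V] exI[of _ E] exI[of _ s] exI[of _ t]) simp
qed simp_all

end
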